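(* Let $A_{-1},A_0,A_1$ be the semi-infinite matrices described in the context, and assume that $A_{-1}\mathbf 1>A_1\mathbf 1$. Let $G$ be the minimal nonnegative solution of $A_1X^2+A_0X+A_{-1}=X$, let $W=I-A_0-A_1G$ and let $L(X)=A_1X^2+(A_0-I)X+A_{-1}$. Let $X_k$, $k=0,1,\ldots$, be the sequence generated by Newton's iteration starting with $X_0=0$, that is, $X_{k+1}=X_k-Z_k$, where $Z_k\in\mathcal L_\infty$ solves \[ (A_1X_k+A_0-I)Z_k+A_1Z_kX_k=L(X_k).\qquad( * ) \] Then, for any $k=0,1,2,\ldots$: 1. equation $( * )$ has a solution $Z_k$ such that $\|Z_k\|_\infty\le\beta$, where \[ \beta=\frac{2\|W^{-1}\|_\infty}{1-\|W^{-1}A_1\|_\infty}, \] so that $X_{k+1}$ is well defined; 2. $Z_k\le0$, $L(X_{k+1})\ge0$ and $0\le X_k\le X_{k+1}\le G$; 3. with $\mathcal E_k=G-X_k$, $\lim_{k\to\infty}(\mathcal E_k)_{i,j}=0$ for any $i,j\ge1$; 4. $\|\mathcal E_{k+1}\|_\infty\le\frac{\tau}{1-\tau}\|\mathcal E_k\|_\infty^2$ and $\|Z_{k+1}\|_\infty\le\frac{\tau}{1-\tau}\|Z_k\|_\infty^2$, where $\tau=\min\{\gamma,\sigma\}$ with \[ \gamma=\max\left\{\frac{a_1(1)}{a_{-1}(1)},\frac{b_1(1)}{b_{-1}(1)}\right\},\qquad \sigma=1-\min\bigl(a_{-1}(1)-a_1(1),\,b_{-1}(1)-b_1(1)\bigr).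 \]
   Context: For $i=-1,0,1$, $A_i$ is the semi-infinite tridiagonal matrix (rows and columns indexed by $1,2,\ldots$) whose first row is $[b_{i,0},b_{i,1},0,\ldots]$ and whose $r$-th row, $r\ge2$, has entries $a_{i,-1},a_{i,0},a_{i,1}$ in columns $r-1,r,r+1$ and zeros elsewhere. Here $a_{i,j}\ge0$, $b_{i,j}\ge0$, $\sum_{i,j=-1}^1a_{i,j}=1$ and $\sum_{i=-1}^1\sum_{j=0}^1b_{i,j}=1$. Hence $(A_{-1}+A_0+A_1)\mathbf 1=\mathbf 1$, where $\mathbf 1$ is the infinite vector of all ones. Set $a_i(z)=a_{i,-1}z^{-1}+a_{i,0}+a_{i,1}z$ and $b_i(z)=b_{i,0}+b_{i,1}z$. Inequalities between vectors and matrices are entrywise; thus $A_{-1}\mathbf 1>A_1\mathbf 1$ means $a_{-1}(1)>a_1(1)$ and $b_{-1}(1)>b_1(1)$. $\mathcal L_\infty$ is the Banach algebra of semi-infinite matrices $A=(a_{i,j})$ that define bounded operators $\ell^\infty\to\ell^\infty$, with norm $\|A\|_\infty=\sup_i\sum_j|a_{i,j}|$; $I$ is the identity matrix. A solution $X\ge0$ of a matrix equation is minimal nonnegative if $Y-X\ge0$ for every other nonnegative solution $Y$. It is known that the minimal nonnegative solution $G$ of $A_1X^2+A_0X+A_{-1}=X$ exists and that $G\mathbf 1\le\mathbf 1$. *)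

theory Defs
  imports Complex_Main "HOL-Library.Function_Algebras"
begin

text \<open>Semi-infinite matrices and vectors are functions on \<^typ>\<open>nat\<close>; the mathematical row and
  column index \<open>r \<ge> 1\<close> is represented by \<open>r - 1\<close>. Addition, subtraction, \<open>0\<close> and \<open>\<le>\<close> are the
  pointwise ones, so \<open>1 :: inf_vec\<close> is the all-ones vector. (On functions \<open><\<close> is not entrywise
  strict, and the library's \<open>1\<close> and \<open>*\<close> on matrices are the entrywise ones; they are not used.)\<close>

type_synonym inf_vec = "nat \<Rightarrow> real"
type_synonym inf_mat = "nat \<Rightarrow> nat \<Rightarrow> real"

definition mat_vec :: "inf_mat \<Rightarrow> inf_vec \<Rightarrow> inf_vec" where
  "mat_vec A x = (\<lambda>i. \<Sum>j. A i j * x j)"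

definition mat_mult :: "inf_mat \<Rightarrow> inf_mat \<Rightarrow> inf_mat" (infixl "\<odot>" 70) where
  "A \<odot> B = (\<lambda>i j. \<Sum>k. A i k * B k j)"

text \<open>Outside this predicate the value of \<^term>\<open>A \<odot> B\<close> is meaningless.\<close>

definition mat_mult_defined :: "inf_mat \<Rightarrow> inf_mat \<Rightarrow> bool" where
  "mat_mult_defined A B \<longleftrightarrow> (\<forall>i j. summable (\<lambda>k. A i k * B k j))"

definition mat_id :: inf_mat where
  "mat_id = (\<lambda>i j. if i = j then 1 else 0)"

text \<open>\<open>A\<close> maps bounded sequences to bounded sequences, with \<open>\<parallel>A x\<parallel>\<^sub>\<infinity> \<le> C \<parallel>x\<parallel>\<^sub>\<infinity>\<close>.\<close>

definition Linf :: "inf_mat set" where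
  "Linf = {A. \<exists>C. \<forall>x M. (\<forall>j. \<bar>x j\<bar> \<le> M) \<longrightarrow>
      (\<forall>i. summable (\<lambda>j. A i j * x j) \<and> \<bar>mat_vec A x i\<bar> \<le> C * M)}"

definition norm_inf :: "inf_mat \<Rightarrow> real" where
  "norm_inf A = (SUP i. \<Sum>j. \<bar>A i j\<bar>)"

text \<open>The row sums are uniformly bounded, so \<^const>\<open>norm_inf\<close> is a genuine supremum on \<^const>\<open>Linf\<close>.\<close>

lemma Linf_iff:
  "A \<in> Linf \<longleftrightarrow> (\<forall>i. summable (\<lambda>j. \<bar>A i j\<bar>)) \<and> bdd_above (range (\<lambda>i. \<Sum>j. \<bar>A i j\<bar>))"
proof
  assume "A \<in> Linf"
  then obtain C where "\<forall>x M. (\<forall>j. \<bar>x j\<bar> \<le> M) \<longrightarrow>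
      (\<forall>i. summable (\<lambda>j. A i j * x j) \<and> \<bar>mat_vec A x i\<bar> \<le> C * M)"
    unfolding Linf_def mem_Collect_eq by (rule exE)
  then have C: "summable (\<lambda>j. A i j * x j) \<and> \<bar>mat_vec A x i\<bar> \<le> C * M"
    if "\<forall>j. \<bar>x j\<bar> \<le> M" for x M i
    using that by simp
  have *: "summable (\<lambda>j. \<bar>A i j\<bar>) \<and> (\<Sum>j. \<bar>A i j\<bar>) \<le> C" for i
  proof -
    have "\<forall>j. \<bar>sgn (A i j)\<bar> \<le> 1" by (simp add: sgn_real_def)
    from C[OF this, of i] show ?thesis
      by (auto simp: mat_vec_def abs_sgn [symmetric] dest: abs_le_D1)
  qed
  then show "(\<forall>i. summable (\<lambda>j. \<bar>A i j\<bar>)) \<and> bdd_above (range (\<lambda>i. \<Sum>j. \<bar>A i j\<bar>))"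
    by (auto intro!: bdd_aboveI2[of _ _ C])
next
  assume R: "(\<forall>i. summable (\<lambda>j. \<bar>A i j\<bar>)) \<and> bdd_above (range (\<lambda>i. \<Sum>j. \<bar>A i j\<bar>))"
  then obtain C where C: "\<And>i. (\<Sum>j. \<bar>A i j\<bar>) \<le> C" unfolding bdd_above_def by auto
  have "summable (\<lambda>j. A i j * x j) \<and> \<bar>mat_vec A x i\<bar> \<le> C * M" if x: "\<forall>j. \<bar>x j\<bar> \<le> M" for x :: inf_vec and M i
  proof -
    have M: "0 \<le> M" using x [rule_format, of 0] by linarith
    have le: "\<bar>A i j * x j\<bar> \<le> \<bar>A i j\<bar> * M" for j using x by (simp add: abs_mult mult_left_mono)
    have s: "summable (\<lambda>j. \<bar>A i j\<bar> * M)" using R by (simp add: summable_mult2)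
    have a: "summable (\<lambda>j. \<bar>A i j * x j\<bar>)"
      by (rule summable_comparison_test'[OF s, of 0]) (use le in auto)
    have "\<bar>mat_vec A x i\<bar> \<le> (\<Sum>j. \<bar>A i j * x j\<bar>)"
      unfolding mat_vec_def using summable_rabs[OF a] .
    also have "\<dots> \<le> (\<Sum>j. \<bar>A i j\<bar> * M)" by (rule suminf_le[OF le a s])
    also have "\<dots> = (\<Sum>j. \<bar>A i j\<bar>) * M" using R by (intro suminf_mult2 [symmetric]) simp
    also have "\<dots> \<le> C * M" using C M by (simp add: mult_right_mono)
    finally show ?thesis using summable_rabs_cancel [OF a] by simp
  qed
  then show "A \<in> Linf" unfolding Linf_def by blast
qed

definition is_Linf_inverse :: "inf_mat \<Rightarrow> inf_mat \<Rightarrow> bool" where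
  "is_Linf_inverse W V \<longleftrightarrow> W \<in> Linf \<and> V \<in> Linf \<and> W \<odot> V = mat_id \<and> V \<odot> W = mat_id"

definition Linf_inv :: "inf_mat \<Rightarrow> inf_mat" where
  "Linf_inv W = (THE V. is_Linf_inverse W V)"

text \<open>The data are \<open>a i j\<close> for \<open>i, j \<in> {-1, 0, 1}\<close> and \<open>b i j\<close> for \<open>i \<in> {-1, 0, 1}\<close>, \<open>j \<in> {0, 1}\<close>;
  other values are irrelevant.\<close>

definition qbd_matrix ::
    "(int \<Rightarrow> int \<Rightarrow> real) \<Rightarrow> (int \<Rightarrow> int \<Rightarrow> real) \<Rightarrow> int \<Rightarrow> inf_mat" where
  "qbd_matrix a b i = (\<lambda>r s.
     if r = 0 then (if s = 0 then b i 0 else if s = 1 then b i 1 else 0)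
     else if s + 1 = r then a i (-1)
     else if s = r then a i 0
     else if s = r + 1 then a i 1
     else 0)"

definition a_symbol :: "(int \<Rightarrow> int \<Rightarrow> real) \<Rightarrow> int \<Rightarrow> real \<Rightarrow> real" where
  "a_symbol a i z = a i (-1) * inverse z + a i 0 + a i 1 * z"

definition b_symbol :: "(int \<Rightarrow> int \<Rightarrow> real) \<Rightarrow> int \<Rightarrow> real \<Rightarrow> real" where
  "b_symbol b i z = b i 0 + b i 1 * z"

lemma mat_vec_qbd_matrix_1:
  "mat_vec (qbd_matrix a b i) 1 r = (if r = 0 then b_symbol b i 1 else a_symbol a i 1)"
proof (cases r)
  case 0
  have "(\<Sum>s. qbd_matrix a b i 0 s * 1) = (\<Sum>s\<in>{0, 1}. qbd_matrix a b i 0 s * 1)"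
    by (rule suminf_finite) (auto simp: qbd_matrix_def)
  then show ?thesis using 0 by (simp add: mat_vec_def b_symbol_def qbd_matrix_def)
next
  case (Suc n)
  have "(\<Sum>s. qbd_matrix a b i (Suc n) s * 1) =
      (\<Sum>s\<in>{n, Suc n, Suc (Suc n)}. qbd_matrix a b i (Suc n) s * 1)"
    by (rule suminf_finite) (auto simp: qbd_matrix_def)
  then show ?thesis using Suc by (simp add: mat_vec_def a_symbol_def qbd_matrix_def)
qed

text \<open>Among the products in the quadratic equation only \<open>X\<^sup>2\<close> needs a convergence condition, because
  the rows of \<open>A i\<close> are finitely supported.\<close>

definition quadratic_solution :: "(int \<Rightarrow> inf_mat) \<Rightarrow> inf_mat \<Rightarrow> bool" where
  "quadratic_solution A X \<longleftrightarrow>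
     mat_mult_defined X X \<and> A 1 \<odot> (X \<odot> X) + A 0 \<odot> X + A (-1) = X"

definition minimal_nonneg_solution :: "(int \<Rightarrow> inf_mat) \<Rightarrow> inf_mat \<Rightarrow> bool" where
  "minimal_nonneg_solution A X \<longleftrightarrow>
     quadratic_solution A X \<and> 0 \<le> X \<and>
     (\<forall>Y. quadratic_solution A Y \<and> 0 \<le> Y \<longrightarrow> 0 \<le> Y - X)"

definition L_residual :: "(int \<Rightarrow> inf_mat) \<Rightarrow> inf_mat \<Rightarrow> inf_mat" where
  "L_residual A X = A 1 \<odot> (X \<odot> X) + (A 0 - mat_id) \<odot> X + A (-1)"

definition newton_equation :: "(int \<Rightarrow> inf_mat) \<Rightarrow> inf_mat \<Rightarrow> inf_mat \<Rightarrow> bool" where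
  "newton_equation A X Z \<longleftrightarrow>
     Z \<in> Linf \<and> (A 1 \<odot> X + A 0 - mat_id) \<odot> Z + A 1 \<odot> Z \<odot> X = L_residual A X"

text \<open>Solvability of the Newton equation is not presupposed: \<open>Z k\<close> is a solution whenever there is
  one, and arbitrary otherwise. Hence every finite run of the iteration extends to such a pair of
  sequences, and that the iteration never breaks down is the claim \<open>newton_equation A (X k) (Z k)\<close>
  for all \<open>k\<close>.\<close>

definition newton_iteration ::
    "(int \<Rightarrow> inf_mat) \<Rightarrow> (nat \<Rightarrow> inf_mat) \<Rightarrow> (nat \<Rightarrow> inf_mat) \<Rightarrow> bool" where
  "newton_iteration A X Z \<longleftrightarrow>
     X 0 = 0 \<and>
     (\<forall>k. (\<exists>Y. newton_equation A (X k) Y) \<longrightarrow> newton_equation A (X k) (Z k)) \<and>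
     (\<forall>k. X (Suc k) = X k - Z k)"

end

theory Submission
  imports Defs "HOL-Analysis.Uniform_Limit"
begin

text \<open>With \<open>W = I - A\<^sub>0 - A\<^sub>1 G\<close>, \<open>E = G - X\<^sub>k\<close>, \<open>E' = G - X\<^bsub>k+1\<^esub>\<close>, \<open>Y = - Z\<^sub>k\<close> and \<open>Y' = - Z\<^bsub>k+1\<^esub>\<close> the Newton
  equation gives \<open>L(X\<^bsub>k+1\<^esub>) = A\<^sub>1 Y\<^sup>2\<close>, \<open>W E' = A\<^sub>1 (E' X\<^sub>k + E Y)\<close> and
  \<open>W Y' = A\<^sub>1 (Y' X\<^bsub>k+1\<^esub> + Y\<^sup>2 - E' Y')\<close>. The Newton equation and the equation for \<open>E'\<close>
  have the form \<open>D = C + P D + Q D R\<close> with \<open>P, Q, R \<ge> 0\<close>, \<open>R \<one> \<le> \<one>\<close> and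
  \<open>(P + Q) \<one> \<le> \<sigma> \<one>\<close>, where \<open>\<sigma> < 1\<close> by the drift condition; such an equation is uniquely solvable in
  \<open>\<L>\<^sub>\<infinity>\<close>, with \<open>D \<ge> 0\<close> if \<open>C \<ge> 0\<close>. This yields solvability and all the signs.
  Multiplying by \<open>W\<^sup>-\<^sup>1 \<ge> 0\<close> and using \<open>Y = E - E'\<close> yields \<open>E' \<le> W\<^sup>-\<^sup>1 A\<^sub>1 (E' X\<^sub>k + E\<^sup>2)\<close> and
  \<open>Y' \<le> W\<^sup>-\<^sup>1 A\<^sub>1 (Y' X\<^bsub>k+1\<^esub> + Y\<^sup>2)\<close>, hence the quadratic estimates, because
  \<open>W\<^sup>-\<^sup>1 A\<^sub>1 \<one> \<le> \<tau> \<one>\<close>. Finally the entrywise limit of the increasing sequence \<open>X\<^sub>k \<le> G\<close> is a solution,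
  since \<open>L(X\<^bsub>k+1\<^esub>) = A\<^sub>1 Y\<^sup>2\<close> tends to \<open>0\<close> entrywise, so it is \<open>G\<close> by minimality.\<close>

section \<open>Bounded operators given by infinite matrices\<close>

text \<open>Dominated convergence for series (Tannery). It justifies taking limits inside the
  row-times-column sums of matrix products.\<close>

lemma suminf_tendsto_dominated:
  fixes f :: "nat \<Rightarrow> nat \<Rightarrow> real"
  assumes "\<And>k. (\<lambda>n. f n k) \<longlonglongrightarrow> g k" "\<And>n k. \<bar>f n k\<bar> \<le> M k" "summable M"
  shows "(\<lambda>n. \<Sum>k. f n k) \<longlonglongrightarrow> (\<Sum>k. g k)"
proof -
  have "\<forall>\<^sub>F (k, n) in sequentially \<times>\<^sub>F sequentially. norm (f n k) \<le> M k"
    using assms(2) by (intro always_eventually) auto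
  from tannerys_theorem[OF assms(1) this assms(3)] show ?thesis by simp
qed

lemma Linf_bound:
  assumes "A \<in> Linf"
  obtains C where "\<And>x M i. (\<And>j. \<bar>x j\<bar> \<le> M) \<Longrightarrow> \<bar>mat_vec A x i\<bar> \<le> C * M"
proof -
  from assms obtain C where "\<forall>x M. (\<forall>j. \<bar>x j\<bar> \<le> M) \<longrightarrow>
      (\<forall>i. summable (\<lambda>j. A i j * x j) \<and> \<bar>mat_vec A x i\<bar> \<le> C * M)"
    unfolding Linf_def mem_Collect_eq ..
  then show thesis by (intro that[of C]) blast
qed

lemma Linf_summable: "A \<in> Linf \<Longrightarrow> Bseq x \<Longrightarrow> summable (\<lambda>j. A i j * x j)"
  unfolding Linf_def Bseq_def by auto

lemma Linf_row_summable: "A \<in> Linf \<Longrightarrow> summable (\<lambda>j. \<bar>A i j\<bar>)"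
  by (simp add: Linf_iff)

lemma Linf_row_le_norm_inf: "A \<in> Linf \<Longrightarrow> (\<Sum>j. \<bar>A i j\<bar>) \<le> norm_inf A"
  unfolding norm_inf_def by (rule cSUP_upper) (auto simp: Linf_iff)

lemma Linf_entry_le_norm_inf: "A \<in> Linf \<Longrightarrow> \<bar>A i j\<bar> \<le> norm_inf A"
  using sum_le_suminf[OF Linf_row_summable, of A "{j}" i] Linf_row_le_norm_inf[of A i] by simp

lemma norm_inf_leI: "(\<And>i. (\<Sum>j. \<bar>A i j\<bar>) \<le> c) \<Longrightarrow> norm_inf A \<le> c"
  unfolding norm_inf_def by (rule cSUP_least) auto

lemma LinfI:
  assumes "\<And>i. summable (\<lambda>j. \<bar>A i j\<bar>)" "\<And>i. (\<Sum>j. \<bar>A i j\<bar>) \<le> c"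
  shows "A \<in> Linf"
  using assms unfolding Linf_iff by (auto intro!: bdd_aboveI2)

lemma Linf_dominated:
  assumes "B \<in> Linf" "\<And>i j. \<bar>A i j\<bar> \<le> \<bar>B i j\<bar>"
  shows "A \<in> Linf"
proof -
  have s: "summable (\<lambda>j. \<bar>A i j\<bar>)" for i
    by (rule summable_comparison_test'[OF Linf_row_summable[OF assms(1), of i], of 0]) (use assms(2) in auto)
  have "(\<Sum>j. \<bar>A i j\<bar>) \<le> norm_inf B" for i
    using suminf_le[OF assms(2) s Linf_row_summable[OF assms(1)]] Linf_row_le_norm_inf[OF assms(1), of i]
    by (rule order_trans)
  then show ?thesis using s by (rule LinfI[rotated])
qed

lemma Bseq_column: "A \<in> Linf \<Longrightarrow> Bseq (\<lambda>k. A k j)"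
  by (rule BseqI'[of _ "norm_inf A"]) (simp add: Linf_entry_le_norm_inf)

lemma mat_mult_eq_mat_vec: "(A \<odot> B) i j = mat_vec A (\<lambda>k. B k j) i"
  by (simp add: mat_mult_def mat_vec_def)

text \<open>Associativity reduces to this interchange of two infinite sums. Finite sums over
  \<open>j\<close> pass through the sum over \<open>k\<close>; the remaining limit is dominated by
  \<open>\<bar>A i k\<bar> * (norm_inf B * K)\<close>, which is summable in
  \<open>k\<close>.\<close>

lemma mat_mult_sums:
  assumes A: "A \<in> Linf" and B: "B \<in> Linf" and x: "Bseq x"
  shows "(\<lambda>j. (A \<odot> B) i j * x j) sums mat_vec A (mat_vec B x) i"
proof -
  obtain K where K: "\<And>j. \<bar>x j\<bar> \<le> K" using x by (auto simp: Bseq_def)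
  have K0: "0 \<le> K" using K[of 0] by linarith
  have AB: "summable (\<lambda>k. A i k * B k j)" for j
    using A B by (intro Linf_summable Bseq_column)
  have part: "(\<Sum>j<n. (A \<odot> B) i j * x j) = (\<Sum>k. A i k * (\<Sum>j<n. B k j * x j))" for n
  proof -
    have "(\<Sum>j<n. (A \<odot> B) i j * x j) = (\<Sum>j<n. \<Sum>k. A i k * B k j * x j)"
      using AB by (simp add: mat_mult_def suminf_mult2)
    also have "\<dots> = (\<Sum>k. \<Sum>j<n. A i k * B k j * x j)"
      using AB by (intro suminf_sum[symmetric] summable_mult2)
    finally show ?thesis by (simp add: sum_distrib_left mult.assoc)
  qed
  have "\<bar>A i k * (\<Sum>j<n. B k j * x j)\<bar> \<le> \<bar>A i k\<bar> * (norm_inf B * K)" for n k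
  proof -
    have "\<bar>\<Sum>j<n. B k j * x j\<bar> \<le> (\<Sum>j<n. \<bar>B k j\<bar> * K)"
      using K by (intro order_trans[OF sum_abs] sum_mono) (simp add: abs_mult mult_left_mono)
    also have "\<dots> \<le> norm_inf B * K"
      using sum_le_suminf[OF Linf_row_summable[OF B], of "{..<n}" k] Linf_row_le_norm_inf[OF B, of k] K0
      by (simp add: sum_distrib_right[symmetric] mult_right_mono)
    finally show ?thesis by (simp add: abs_mult mult_left_mono)
  qed
  then have "(\<lambda>n. \<Sum>k. A i k * (\<Sum>j<n. B k j * x j)) \<longlonglongrightarrow> (\<Sum>k. A i k * mat_vec B x k)"
    by (intro suminf_tendsto_dominated[where M = "\<lambda>k. \<bar>A i k\<bar> * (norm_inf B * K)"] tendsto_mult_left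
         summable_mult2 Linf_row_summable A)
       (auto simp: mat_vec_def intro!: summable_LIMSEQ Linf_summable B x)
  then show ?thesis by (simp add: sums_def part mat_vec_def)
qed

lemma mat_vec_mat_mult:
  "A \<in> Linf \<Longrightarrow> B \<in> Linf \<Longrightarrow> Bseq x \<Longrightarrow> mat_vec (A \<odot> B) x = mat_vec A (mat_vec B x)"
  using mat_mult_sums[of A B x] unfolding mat_vec_def[of "A \<odot> B"] by (auto simp: sums_iff)

text \<open>The operator form of \<open>Linf\<close> is convenient here: bounds \<open>C\<close> and
  \<open>D\<close> for the factors compose to \<open>C * D\<close>.\<close>

lemma Linf_mat_mult:
  assumes "A \<in> Linf" "B \<in> Linf"
  shows "A \<odot> B \<in> Linf"
proof -
  obtain C where C: "\<And>x M i. (\<And>j. \<bar>x j\<bar> \<le> M) \<Longrightarrow> \<bar>mat_vec A x i\<bar> \<le> C * M"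
    using Linf_bound[OF assms(1)] by blast
  obtain D where D: "\<And>x M i. (\<And>j. \<bar>x j\<bar> \<le> M) \<Longrightarrow> \<bar>mat_vec B x i\<bar> \<le> D * M"
    using Linf_bound[OF assms(2)] by blast
  have "summable (\<lambda>j. (A \<odot> B) i j * x j) \<and> \<bar>mat_vec (A \<odot> B) x i\<bar> \<le> (C * D) * M"
    if "\<forall>j. \<bar>x j\<bar> \<le> M" for x M i
  proof -
    have x: "Bseq x" by (rule BseqI'[of _ M]) (use that in simp)
    show ?thesis using mat_mult_sums[OF assms x, of i] mat_vec_mat_mult[OF assms x]
        C[of "mat_vec B x" "D * M"] D[of x M] that by (auto simp: sums_iff mult.assoc)
  qed
  then show ?thesis unfolding Linf_def by blast
qed

section \<open>Linear structure and identity of bounded matrices\<close>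

lemma mat_vec_add:
  "A \<in> Linf \<Longrightarrow> B \<in> Linf \<Longrightarrow> Bseq x \<Longrightarrow> mat_vec (A + B) x = mat_vec A x + mat_vec B x"
  by (rule ext) (simp add: mat_vec_def distrib_right suminf_add Linf_summable)

lemma mat_vec_add_right:
  "A \<in> Linf \<Longrightarrow> Bseq x \<Longrightarrow> Bseq y \<Longrightarrow> mat_vec A (\<lambda>k. x k + y k) i = mat_vec A x i + mat_vec A y i"
  by (simp add: mat_vec_def distrib_left suminf_add Linf_summable)

lemma mat_vec_scale_right:
  "A \<in> Linf \<Longrightarrow> Bseq x \<Longrightarrow> mat_vec A (\<lambda>k. c * x k) i = c * mat_vec A x i"
  by (simp add: mat_vec_def mult.left_commute[of _ c] suminf_mult Linf_summable)

lemma mat_vec_scale: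
  "A \<in> Linf \<Longrightarrow> Bseq x \<Longrightarrow> mat_vec (\<lambda>i j. c * A i j) x i = c * mat_vec A x i"
  by (simp add: mat_vec_def mult.assoc suminf_mult Linf_summable)

lemma Linf_add:
  assumes "A \<in> Linf" "B \<in> Linf"
  shows "A + B \<in> Linf"
proof -
  have le: "\<bar>A i j + B i j\<bar> \<le> \<bar>A i j\<bar> + \<bar>B i j\<bar>" for i j by linarith
  have sum: "summable (\<lambda>j. \<bar>A i j\<bar> + \<bar>B i j\<bar>)" for i
    using assms by (intro summable_add Linf_row_summable)
  have s: "summable (\<lambda>j. \<bar>A i j + B i j\<bar>)" for i
    by (rule summable_comparison_test'[OF sum[of i], of 0]) auto
  have "(\<Sum>j. \<bar>A i j + B i j\<bar>) \<le> norm_inf A + norm_inf B" for i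
    using suminf_le[OF le s sum, of i] Linf_row_le_norm_inf[OF assms(1), of i] Linf_row_le_norm_inf[OF assms(2), of i]
    by (simp add: suminf_add[symmetric] Linf_row_summable assms)
  then show ?thesis using s by (intro LinfI[where c = "norm_inf A + norm_inf B"]) simp_all
qed

lemma Linf_scale:
  assumes "A \<in> Linf"
  shows "(\<lambda>i j. c * A i j) \<in> Linf"
proof -
  have "\<bar>c\<bar> * (\<Sum>j. \<bar>A i j\<bar>) \<le> \<bar>c\<bar> * norm_inf A" for i
    by (intro mult_left_mono Linf_row_le_norm_inf assms) simp
  then show ?thesis using Linf_row_summable[OF assms]
    by (intro LinfI[where c = "\<bar>c\<bar> * norm_inf A"]) (auto simp: abs_mult suminf_mult)
qed

lemma Linf_finite_rows:
  assumes "\<And>i. finite (S i)" "\<And>i j. j \<notin> S i \<Longrightarrow> A i j = 0" "\<And>i. (\<Sum>j\<in>S i. \<bar>A i j\<bar>) \<le> C"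
  shows "A \<in> Linf"
proof -
  have "(\<lambda>j. \<bar>A i j\<bar>) sums (\<Sum>j\<in>S i. \<bar>A i j\<bar>)" for i
    using assms by (intro sums_finite) auto
  then show ?thesis using assms(3) by (intro LinfI[where c = C]) (auto simp: sums_iff)
qed

lemma Linf_mat_id: "mat_id \<in> Linf"
  by (rule Linf_finite_rows[of "\<lambda>i. {i}" _ 1]) (auto simp: mat_id_def)

lemma mat_vec_mat_id: "mat_vec mat_id x = x"
proof
  fix i
  have "(\<lambda>j. mat_id i j * x j) sums (\<Sum>j\<in>{i}. mat_id i j * x j)"
    by (rule sums_finite) (auto simp: mat_id_def)
  then show "mat_vec mat_id x i = x i" by (simp add: mat_vec_def mat_id_def sums_iff)
qed

lemma mat_id_mult: "mat_id \<odot> A = A"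
  by (intro ext) (simp add: mat_mult_eq_mat_vec mat_vec_mat_id)

lemma mult_mat_id: "A \<odot> mat_id = A"
proof (intro ext)
  fix i j
  have "(\<lambda>k. A i k * mat_id k j) sums (\<Sum>k\<in>{j}. A i k * mat_id k j)"
    by (rule sums_finite) (auto simp: mat_id_def)
  then show "(A \<odot> mat_id) i j = A i j" by (simp add: mat_mult_def mat_id_def sums_iff)
qed

lemma mat_mult_assoc:
  "A \<in> Linf \<Longrightarrow> B \<in> Linf \<Longrightarrow> C \<in> Linf \<Longrightarrow> A \<odot> B \<odot> C = A \<odot> (B \<odot> C)"
  by (intro ext)
     (simp add: mat_mult_eq_mat_vec[of _ C] mat_vec_mat_mult Bseq_column mat_mult_eq_mat_vec[of A "B \<odot> C"])

section \<open>The ordered algebra of bounded matrices\<close>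

text \<open>As a type, the bounded matrices carry an ordered ring structure in which
  \<open>*\<close> and \<open>1\<close> are the matrix ones, so that the Newton identities become
  ring identities for \<open>algebra_simps\<close>.\<close>

typedef linf = Linf morphisms entry linf_of
  using Linf_mat_id by blast

setup_lifting type_definition_linf

instantiation linf :: ring_1
begin

lift_definition zero_linf :: linf is "\<lambda>i j. 0"
  by (rule Linf_finite_rows[of "\<lambda>i. {}" _ 0]) auto
lift_definition one_linf :: linf is mat_id by (rule Linf_mat_id)
lift_definition plus_linf :: "linf \<Rightarrow> linf \<Rightarrow> linf" is "(+)" by (rule Linf_add)
lift_definition uminus_linf :: "linf \<Rightarrow> linf" is "\<lambda>A i j. - A i j"
  by (rule Linf_dominated) auto
definition minus_linf :: "linf \<Rightarrow> linf \<Rightarrow> linf" where "A - B = A + - (B :: linf)"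
lift_definition times_linf :: "linf \<Rightarrow> linf \<Rightarrow> linf" is "(\<odot>)" by (rule Linf_mat_mult)

instance
proof
  fix a b c :: linf
  show "a * b * c = a * (b * c)" by transfer (rule mat_mult_assoc)
  show "1 * a = a" by transfer (rule mat_id_mult)
  show "a * 1 = a" by transfer (rule mult_mat_id)
  show "a + b + c = a + (b + c)" by transfer (simp add: add.assoc)
  show "a + b = b + a" by transfer (simp add: add.commute)
  show "0 + a = a" by transfer (auto simp: fun_eq_iff)
  show "- a + a = 0" by transfer (auto simp: fun_eq_iff)
  show "a - b = a + - b" by (simp add: minus_linf_def)
  show "(a + b) * c = a * c + b * c"
    by transfer (auto simp: fun_eq_iff mat_mult_eq_mat_vec mat_vec_add Bseq_column)
  show "a * (b + c) = a * b + a * c"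
    by transfer (auto simp: fun_eq_iff mat_mult_eq_mat_vec mat_vec_add_right Bseq_column)
  show "(0 :: linf) \<noteq> 1" by transfer (auto simp: fun_eq_iff mat_id_def)
qed

end

instantiation linf :: ordered_ring
begin

lift_definition less_eq_linf :: "linf \<Rightarrow> linf \<Rightarrow> bool" is "(\<le>)" .
definition less_linf :: "linf \<Rightarrow> linf \<Rightarrow> bool" where "A < B \<longleftrightarrow> A \<le> B \<and> \<not> B \<le> (A :: linf)"

lemma mult_nonneg_linf: "0 \<le> a \<Longrightarrow> 0 \<le> b \<Longrightarrow> 0 \<le> a * (b :: linf)"
  by transfer (auto simp: le_fun_def mat_mult_def intro!: suminf_nonneg Linf_summable Bseq_column)

instance
proof
  fix a b c :: linf
  show "(a < b) = (a \<le> b \<and> \<not> b \<le> a)" by (simp add: less_linf_def)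
  show "a \<le> a" by transfer simp
  show "a \<le> b \<Longrightarrow> b \<le> c \<Longrightarrow> a \<le> c" by transfer (rule order_trans)
  show "a \<le> b \<Longrightarrow> b \<le> a \<Longrightarrow> a = b" by transfer (rule antisym)
  show add: "a \<le> b \<Longrightarrow> c + a \<le> c + b" for a b c :: linf by transfer (simp add: le_fun_def)
  have diff: "a \<le> b \<longleftrightarrow> 0 \<le> b - a" for a b :: linf
    using add[of a b "- a"] add[of 0 "b - a" a] by auto
  show "a \<le> b \<Longrightarrow> 0 \<le> c \<Longrightarrow> c * a \<le> c * b"
    using mult_nonneg_linf[of c "b - a"] by (simp add: diff[of a] diff[of "c * a"] right_diff_distrib)
  show "a \<le> b \<Longrightarrow> 0 \<le> c \<Longrightarrow> a * c \<le> b * c"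
    using mult_nonneg_linf[of "b - a" c] by (simp add: diff[of a] diff[of "a * c"] left_diff_distrib)
qed

end

instantiation linf :: "{real_algebra_1, ordered_real_vector}"
begin

lift_definition scaleR_linf :: "real \<Rightarrow> linf \<Rightarrow> linf" is "\<lambda>c A i j. c * A i j" by (rule Linf_scale)

instance
proof
  fix a b :: real and x y :: linf
  show "a *\<^sub>R (x + y) = a *\<^sub>R x + a *\<^sub>R y" by transfer (auto simp: fun_eq_iff algebra_simps)
  show "(a + b) *\<^sub>R x = a *\<^sub>R x + b *\<^sub>R x" by transfer (auto simp: fun_eq_iff algebra_simps)
  show "a *\<^sub>R b *\<^sub>R x = (a * b) *\<^sub>R x" by transfer (auto simp: fun_eq_iff algebra_simps)
  show "1 *\<^sub>R x = x" by transfer simp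
  show "a *\<^sub>R x * y = a *\<^sub>R (x * y)"
    by transfer (simp add: fun_eq_iff mat_mult_eq_mat_vec mat_vec_scale Bseq_column)
  show "x * a *\<^sub>R y = a *\<^sub>R (x * y)"
    by transfer (simp add: fun_eq_iff mat_mult_eq_mat_vec mat_vec_scale_right Bseq_column)
  show "x \<le> y \<Longrightarrow> 0 \<le> a \<Longrightarrow> a *\<^sub>R x \<le> a *\<^sub>R y"
    by transfer (auto simp: le_fun_def intro: mult_left_mono)
  show "a \<le> b \<Longrightarrow> 0 \<le> x \<Longrightarrow> a *\<^sub>R x \<le> b *\<^sub>R x"
    by transfer (auto simp: le_fun_def intro: mult_right_mono)
qed

end

instantiation linf :: ordered_ab_group_add_abs
begin

lift_definition abs_linf :: "linf \<Rightarrow> linf" is "\<lambda>A i j. \<bar>A i j\<bar>"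
  by (rule Linf_dominated) auto

instance
proof
  fix a b :: linf
  show "0 \<le> \<bar>a\<bar>" by transfer (simp add: le_fun_def)
  show "a \<le> \<bar>a\<bar>" by transfer (auto simp: le_fun_def abs_ge_self)
  show "a \<le> b \<Longrightarrow> - a \<le> b \<Longrightarrow> \<bar>a\<bar> \<le> b" by transfer (auto simp: le_fun_def abs_le_iff)
  show "\<bar>- a\<bar> = \<bar>a\<bar>" by transfer simp
  show "\<bar>a + b\<bar> \<le> \<bar>a\<bar> + \<bar>b\<bar>" by transfer (simp add: le_fun_def abs_triangle_ineq)
qed

end

text \<open>Triangle inequality in each entry. It reduces matrices of unknown sign to nonnegative
  ones, whose row sums control the norm.\<close>

lemma abs_mult_le_linf: "\<bar>A * B\<bar> \<le> \<bar>A\<bar> * \<bar>B :: linf\<bar>"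
proof (transfer, intro le_funI)
  fix A B :: inf_mat and i j
  assume A: "A \<in> Linf" and B: "B \<in> Linf"
  have "\<bar>B k j\<bar> \<le> norm_inf B" for k by (rule Linf_entry_le_norm_inf[OF B])
  then have "summable (\<lambda>k. \<bar>A i k\<bar> * \<bar>B k j\<bar>)"
    by (intro summable_comparison_test'[OF summable_mult2[OF Linf_row_summable[OF A, of i], of "norm_inf B"], of 0])
       (simp add: abs_mult mult_left_mono)
  then show "\<bar>(A \<odot> B) i j\<bar> \<le> ((\<lambda>i j. \<bar>A i j\<bar>) \<odot> (\<lambda>i j. \<bar>B i j\<bar>)) i j"
    using summable_rabs[of "\<lambda>k. A i k * B k j"] by (simp add: mat_mult_def abs_mult)
qed

lemma entry_in_Linf [simp]: "entry X \<in> Linf"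
  by (rule entry)

lemma entry_nonneg_iff: "0 \<le> X \<longleftrightarrow> (\<forall>i j. 0 \<le> entry X i j)"
  by (simp add: less_eq_linf.rep_eq le_fun_def zero_linf.rep_eq)

lemma entry_le_iff: "X \<le> Y \<longleftrightarrow> (\<forall>i j. entry X i j \<le> entry Y i j)"
  by (simp add: less_eq_linf.rep_eq le_fun_def)

lemmas entry_nonneg = entry_nonneg_iff[THEN iffD1, rule_format]

lemmas entry_mono = entry_le_iff[THEN iffD1, rule_format]

lemma entry_add: "entry (X + Y) i j = entry X i j + entry Y i j"
  by (simp add: plus_linf.rep_eq)

lemma entry_minus: "entry (- X) i j = - entry X i j"
  by (simp add: uminus_linf.rep_eq)

lemma entry_diff: "entry (X - Y) i j = entry X i j - entry Y i j"
  by (simp only: minus_linf_def entry_add entry_minus diff_conv_add_uminus)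

lemma entry_mult: "entry (X * Y) i j = (\<Sum>k. entry X i k * entry Y k j)"
  by (simp add: times_linf.rep_eq mat_mult_def)

lemma entry_eqI: "(\<And>i j. entry X i j = entry Y i j) \<Longrightarrow> X = Y"
  by (simp add: entry_inject[symmetric] ext)

lemma norm_inf_entry_nonneg: "0 \<le> norm_inf (entry X)"
  using Linf_entry_le_norm_inf[of "entry X" 0 0] by simp

text \<open>The first column of \<open>X * ones\<close> is the vector of row sums of \<open>X\<close> and the other columns vanish,
  so vectors need no type of their own: \<open>X \<one> \<le> Y \<one>\<close> becomes \<open>X * ones \<le> Y * ones\<close>.\<close>

lift_definition ones :: linf is "\<lambda>i j. if j = 0 then 1 else 0"
  by (rule Linf_finite_rows[of "\<lambda>_. {0}" _ 1]) auto

lemma ones_nonneg: "0 \<le> ones"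
  by (simp add: entry_nonneg_iff ones.rep_eq)

lemma entry_mult_ones: "entry (X * ones) i j = (if j = 0 then mat_vec (entry X) 1 i else 0)"
  by (simp add: entry_mult ones.rep_eq mat_vec_def)

lemma entry_scaleR: "entry (c *\<^sub>R X) i j = c * entry X i j"
  by (simp add: scaleR_linf.rep_eq)

text \<open>A nonnegative matrix has its row sums as absolute row sums, so a norm bound is an
  inequality in the ordered ring and norm estimates follow by monotonicity.\<close>

lemma ones_le_iff:
  assumes "0 \<le> X"
  shows "X * ones \<le> c *\<^sub>R ones \<longleftrightarrow> norm_inf (entry X) \<le> c"
proof -
  have "mat_vec (entry X) 1 i = (\<Sum>j. \<bar>entry X i j\<bar>)" for i
    using assms by (simp add: mat_vec_def entry_nonneg_iff)
  then have "X * ones \<le> c *\<^sub>R ones \<longleftrightarrow> (\<forall>i. (\<Sum>j. \<bar>entry X i j\<bar>) \<le> c)"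
    by (auto simp: entry_le_iff entry_mult_ones entry_scaleR ones.rep_eq)
  also have "\<dots> \<longleftrightarrow> norm_inf (entry X) \<le> c"
    using order_trans[OF Linf_row_le_norm_inf[OF entry_in_Linf, of X]] by (auto intro: norm_inf_leI)
  finally show ?thesis .
qed

lemmas mult_ones_le_norm = ones_le_iff[THEN iffD2, OF _ order_refl]

lemma norm_inf_abs: "norm_inf (entry \<bar>X\<bar>) = norm_inf (entry X)"
  by (simp add: norm_inf_def abs_linf.rep_eq)

lemma norm_inf_le_zero: "norm_inf (entry X) \<le> 0 \<Longrightarrow> X = 0"
proof (rule entry_eqI)
  fix i j
  assume "norm_inf (entry X) \<le> 0"
  with Linf_entry_le_norm_inf[OF entry_in_Linf, of X i j] show "entry X i j = entry 0 i j"
    by (simp add: zero_linf.rep_eq)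
qed

lemma norm_inf_mult_le:
  assumes "0 \<le> A" "0 \<le> B"
  shows "norm_inf (entry (A * B)) \<le> norm_inf (entry A) * norm_inf (entry B)"
proof -
  have "A * (B * ones) \<le> A * (norm_inf (entry B) *\<^sub>R ones)"
    using assms by (intro mult_left_mono mult_ones_le_norm)
  also have "\<dots> \<le> norm_inf (entry B) *\<^sub>R (norm_inf (entry A) *\<^sub>R ones)"
    using mult_ones_le_norm[OF assms(1)]
    by (simp del: scaleR_scaleR add: scaleR_left_mono norm_inf_entry_nonneg)
  finally show ?thesis using assms
    by (simp add: ones_le_iff[symmetric] mult_nonneg_nonneg mult.assoc mult.commute[of "norm_inf (entry B)"])
qed

lemma two_sided_mult_ones_le:
  assumes "0 \<le> P" "0 \<le> Q" "0 \<le> Y" "R * ones \<le> ones" "(P + Q) * ones \<le> c *\<^sub>R ones"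
    "Y * ones \<le> d *\<^sub>R ones" "0 \<le> d"
  shows "(P * Y + Q * Y * R) * ones \<le> (d * c) *\<^sub>R ones"
proof -
  have "Q * Y * (R * ones) \<le> Q * Y * ones" using assms by (intro mult_left_mono mult_nonneg_nonneg)
  then have "(P * Y + Q * Y * R) * ones \<le> P * (Y * ones) + Q * (Y * ones)"
    by (simp add: distrib_right mult.assoc)
  also have "\<dots> = (P + Q) * (Y * ones)" by (simp add: distrib_right)
  also have "\<dots> \<le> (P + Q) * (d *\<^sub>R ones)" using assms by (intro mult_left_mono) auto
  also have "\<dots> \<le> d *\<^sub>R (c *\<^sub>R ones)" using assms by (simp del: scaleR_scaleR add: scaleR_left_mono)
  finally show ?thesis by simp
qed

text \<open>The matrix \<open>\<bar>D\<bar>\<close> is dominated by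
  \<open>P * \<bar>D\<bar> + Q * \<bar>D\<bar> * R\<close>, so the norm \<open>n\<close> of
  \<open>D\<close> satisfies \<open>n \<le> n * c\<close> with \<open>c < 1\<close>.\<close>

lemma two_sided_fixpoint_zero:
  assumes "0 \<le> P" "0 \<le> Q" "0 \<le> R" "R * ones \<le> ones" "(P + Q) * ones \<le> c *\<^sub>R ones" "c < 1"
    and D: "D = P * D + Q * D * R"
  shows "D = 0"
proof -
  let ?n = "norm_inf (entry D)"
  have n: "0 \<le> ?n" by (rule norm_inf_entry_nonneg)
  have "\<bar>D\<bar> \<le> \<bar>P * D\<bar> + \<bar>Q * D * R\<bar>" using abs_triangle_ineq[of "P * D" "Q * D * R"] by (simp add: D[symmetric])
  also have "\<bar>P * D\<bar> \<le> P * \<bar>D\<bar>" using abs_mult_le_linf[of P D] assms by simp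
  also have "\<bar>Q * D * R\<bar> \<le> Q * \<bar>D\<bar> * R"
    using order_trans[OF abs_mult_le_linf[of "Q * D" R] mult_right_mono[OF abs_mult_le_linf[of Q D], of "\<bar>R\<bar>"]] assms by simp
  finally have le: "\<bar>D\<bar> \<le> P * \<bar>D\<bar> + Q * \<bar>D\<bar> * R" by simp
  have "\<bar>D\<bar> * ones \<le> (P * \<bar>D\<bar> + Q * \<bar>D\<bar> * R) * ones" using le ones_nonneg by (rule mult_right_mono)
  also have "\<dots> \<le> (?n * c) *\<^sub>R ones"
    using assms n by (intro two_sided_mult_ones_le) (auto simp: ones_le_iff norm_inf_abs)
  finally have "?n \<le> ?n * c" by (simp add: ones_le_iff norm_inf_abs)
  with \<open>c < 1\<close> n have "?n \<le> 0" by (auto simp: mult_le_cancel_left1)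
  then show ?thesis by (rule norm_inf_le_zero)
qed

section \<open>Entrywise limits and two-sided linear equations\<close>

text \<open>Convergence is entrywise because increasing sequences with bounded row sums converge in
  this sense, but in general not in norm.\<close>

definition tends :: "(nat \<Rightarrow> linf) \<Rightarrow> linf \<Rightarrow> bool" where
  "tends X S \<longleftrightarrow> (\<forall>i j. (\<lambda>n. entry (X n) i j) \<longlonglongrightarrow> entry S i j)"

lemma tends_const: "tends (\<lambda>n. S) S"
  by (simp add: tends_def)

lemma tends_add: "tends X S \<Longrightarrow> tends Y T \<Longrightarrow> tends (\<lambda>n. X n + Y n) (S + T)"
  by (simp add: tends_def entry_add tendsto_add)

lemma tends_diff: "tends X S \<Longrightarrow> tends Y T \<Longrightarrow> tends (\<lambda>n. X n - Y n) (S - T)"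
  by (simp add: tends_def entry_diff tendsto_diff)

lemma tends_Suc: "tends X S \<Longrightarrow> tends (\<lambda>n. X (Suc n)) S"
  unfolding tends_def by (auto intro: LIMSEQ_Suc[where f = "\<lambda>n. entry (X n) i j" for i j])

lemma tends_unique: "tends X S \<Longrightarrow> tends X T \<Longrightarrow> S = T"
  using LIMSEQ_unique unfolding tends_def by (blast intro: entry_eqI)

text \<open>Entrywise limits do not respect products in general, since mass can escape along a row.
  The fixed majorants prevent this: the rows of \<open>B\<close> are summable and the columns of
  \<open>C\<close> are bounded.\<close>

lemma tends_mult:
  assumes "tends X S" "tends Y T" "\<And>n. 0 \<le> X n" "\<And>n. X n \<le> B" "\<And>n. 0 \<le> Y n" "\<And>n. Y n \<le> C"
  shows "tends (\<lambda>n. X n * Y n) (S * T)"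
  unfolding tends_def entry_mult
proof (intro allI suminf_tendsto_dominated)
  fix i j k
  show "(\<lambda>n. entry (X n) i k * entry (Y n) k j) \<longlonglongrightarrow> entry S i k * entry T k j"
    using assms(1,2) by (auto simp: tends_def intro: tendsto_mult)
  show "summable (\<lambda>k. \<bar>entry B i k\<bar> * norm_inf (entry C))"
    by (intro summable_mult2 Linf_row_summable entry_in_Linf)
  fix n
  have "\<bar>entry (X n) i k\<bar> \<le> \<bar>entry B i k\<bar>" "\<bar>entry (Y n) k j\<bar> \<le> \<bar>entry C k j\<bar>"
    using entry_nonneg[OF assms(3)[of n]] entry_mono[OF assms(4)[of n]]
      entry_nonneg[OF assms(5)[of n]] entry_mono[OF assms(6)[of n]]
    by (auto intro: order_trans[OF _ abs_ge_self])
  then show "\<bar>entry (X n) i k * entry (Y n) k j\<bar> \<le> \<bar>entry B i k\<bar> * norm_inf (entry C)"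
    using Linf_entry_le_norm_inf[of "entry C" k j] unfolding abs_mult by (intro mult_mono) auto
qed

lemma increasing_bounded_tends:
  assumes inc: "\<And>n. X n \<le> X (Suc n)" and nonneg: "\<And>n. 0 \<le> X n" and bound: "\<And>n. X n * ones \<le> c *\<^sub>R ones"
  obtains S where "tends X S" "\<And>n. X n \<le> S" "S * ones \<le> c *\<^sub>R ones"
proof -
  have norm: "norm_inf (entry (X n)) \<le> c" for n using bound[of n] nonneg by (simp add: ones_le_iff)
  have mono: "incseq (\<lambda>n. entry (X n) i j)" for i j
    using inc by (intro incseq_SucI) (simp add: entry_le_iff)
  have "\<bar>entry (X n) i j\<bar> \<le> c" for n i j
    using Linf_entry_le_norm_inf[of "entry (X n)" i j] norm[of n] by simp
  then have "\<exists>l. (\<lambda>n. entry (X n) i j) \<longlonglongrightarrow> l \<and> (\<forall>n. entry (X n) i j \<le> l)" for i j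
    using incseq_convergent[OF mono, of i j c] by (metis abs_le_D1)
  then obtain l where l: "\<And>i j. (\<lambda>n. entry (X n) i j) \<longlonglongrightarrow> l i j" "\<And>n i j. entry (X n) i j \<le> l i j"
    by metis
  have l0: "0 \<le> l i j" for i j
    by (rule order_trans[OF _ l(2)[of 0]]) (use nonneg[of 0] in \<open>simp add: entry_nonneg_iff\<close>)
  \<comment> \<open>The bound on the row sums survives the limit for each finite partial sum; it
    then gives summability of the limit rows.\<close>
  have part: "(\<Sum>j<m. l i j) \<le> c" for i m
  proof (rule LIMSEQ_le_const2)
    show "(\<lambda>n. \<Sum>j<m. entry (X n) i j) \<longlonglongrightarrow> (\<Sum>j<m. l i j)" by (intro tendsto_sum l)
    have "(\<Sum>j<m. entry (X n) i j) \<le> c" for n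
      using sum_le_suminf[OF Linf_row_summable[of "entry (X n)" i], of "{..<m}"] nonneg[of n]
        Linf_row_le_norm_inf[of "entry (X n)" i] norm[of n] by (simp add: entry_nonneg_iff)
    then show "\<exists>N. \<forall>n\<ge>N. (\<Sum>j<m. entry (X n) i j) \<le> c" by blast
  qed
  have sl: "summable (\<lambda>j. l i j)" for i by (rule summableI_nonneg_bounded[OF l0 part])
  have row: "(\<Sum>j. \<bar>l i j\<bar>) \<le> c" for i using suminf_le_const[OF sl part] l0 by simp
  have "l \<in> Linf" using sl row l0 by (intro LinfI[where c = c]) auto
  then obtain S where S: "entry S = l" by (metis linf_of_inverse)
  show thesis
  proof
    show "tends X S" using l(1) by (simp add: tends_def S)
    show "X n \<le> S" for n using l(2) by (simp add: entry_le_iff S)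
    show "S * ones \<le> c *\<^sub>R ones"
      using l0 row by (simp add: ones_le_iff entry_nonneg_iff S norm_inf_leI)
  qed
qed

text \<open>The iterates from \<open>0\<close> increase with row sums at most \<open>c\<close>, so
  they have an entrywise limit, which \<open>cont\<close> makes a fixed point. It serves both the
  linear two-sided equation and the quadratic one.\<close>

lemma monotone_iteration_fixpoint:
  assumes nonneg: "\<And>X. 0 \<le> X \<Longrightarrow> 0 \<le> F X"
    and mono: "\<And>X Y. 0 \<le> X \<Longrightarrow> X \<le> Y \<Longrightarrow> F X \<le> F Y"
    and bound: "\<And>X. 0 \<le> X \<Longrightarrow> X * ones \<le> c *\<^sub>R ones \<Longrightarrow> F X * ones \<le> c *\<^sub>R ones"
    and cont: "\<And>X S. tends X S \<Longrightarrow> (\<And>n. 0 \<le> X n) \<Longrightarrow> (\<And>n. X n \<le> S) \<Longrightarrow> tends (\<lambda>n. F (X n)) (F S)"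
    and c: "0 \<le> c"
  obtains S where "0 \<le> S" "S * ones \<le> c *\<^sub>R ones" "F S = S"
proof -
  define X where "X n = (F ^^ n) 0" for n
  have X: "X 0 = 0" "X (Suc n) = F (X n)" for n by (simp_all add: X_def)
  have nn: "0 \<le> X n" for n by (induction n) (simp_all add: X nonneg)
  have inc: "X n \<le> X (Suc n)" for n
  proof (induction n)
    case 0
    show ?case using nn[of "Suc 0"] by (simp add: X(1))
  next
    case (Suc n)
    show ?case using mono[OF nn Suc] by (simp add: X(2))
  qed
  have "X n * ones \<le> c *\<^sub>R ones" for n
  proof (induction n)
    case 0
    show ?case using c ones_nonneg by (simp add: X(1) scaleR_nonneg_nonneg)
  next
    case (Suc n)
    show ?case using bound[OF nn Suc] by (simp add: X(2))
  qed
  from increasing_bounded_tends[of X, OF inc nn this] obtain S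
    where S: "tends X S" "\<And>n. X n \<le> S" "S * ones \<le> c *\<^sub>R ones" by blast
  have "F S = S" using tends_unique[OF cont[OF S(1) nn S(2)]] tends_Suc[OF S(1)] by (simp add: X(2))
  moreover have "0 \<le> S" using nn S(2) order_trans by blast
  ultimately show thesis using that S(3) by blast
qed

lemma two_sided_fixpoint:
  assumes P: "0 \<le> P" and Q: "0 \<le> Q" and R: "0 \<le> R" "R * ones \<le> ones"
    and PQ: "(P + Q) * ones \<le> c *\<^sub>R ones" "c < 1" and C: "0 \<le> C"
  obtains Y where "0 \<le> Y" "Y = C + P * Y + Q * Y * R"
proof -
  \<comment> \<open>This \<open>d\<close> solves \<open>norm_inf (entry C) + d * c = d\<close>, so
    the bound \<open>Y * ones \<le> d *\<^sub>R ones\<close> is preserved by the iteration.\<close>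
  define d where "d = norm_inf (entry C) / (1 - c)"
  have d: "0 \<le> d" using PQ(2) by (simp add: d_def norm_inf_entry_nonneg)
  have eq: "norm_inf (entry C) + d * c = d" using PQ(2) by (simp add: d_def field_simps)
  define F where "F Y = C + P * Y + Q * Y * R" for Y
  obtain Y where "0 \<le> Y" "Y * ones \<le> d *\<^sub>R ones" "F Y = Y"
  proof (rule monotone_iteration_fixpoint[of F d])
    show "0 \<le> F Y" if "0 \<le> Y" for Y
      unfolding F_def using assms that by (intro add_nonneg_nonneg mult_nonneg_nonneg)
    show "F X \<le> F Y" if "0 \<le> X" "X \<le> Y" for X Y
      unfolding F_def using assms that by (intro add_mono mult_right_mono mult_left_mono) auto
    show "F Y * ones \<le> d *\<^sub>R ones" if "0 \<le> Y" "Y * ones \<le> d *\<^sub>R ones" for Y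
    proof -
      have "F Y * ones = C * ones + (P * Y + Q * Y * R) * ones" by (simp add: F_def algebra_simps)
      also have "\<dots> \<le> norm_inf (entry C) *\<^sub>R ones + (d * c) *\<^sub>R ones"
        by (intro add_mono mult_ones_le_norm two_sided_mult_ones_le assms that d)
      finally show ?thesis by (simp add: scaleR_add_left[symmetric] eq)
    qed
    show "tends (\<lambda>n. F (X n)) (F S)" if "tends X S" "\<And>n. 0 \<le> X n" "\<And>n. X n \<le> S" for X S
    proof -
      have "tends (\<lambda>n. Q * X n) (Q * S)"
        by (rule tends_mult[OF tends_const that(1) Q order_refl that(2,3)])
      then have "tends (\<lambda>n. Q * X n * R) (Q * S * R)"
        by (rule tends_mult[OF _ tends_const, where B = "Q * S" and C = R])
           (use that Q R in \<open>auto intro: mult_left_mono\<close>)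
      then show ?thesis unfolding F_def
        by (intro tends_add tends_const tends_mult[OF tends_const that(1) P order_refl that(2,3)])
    qed
  qed (use d in auto)
  then show thesis using that by (simp add: F_def)
qed

text \<open>The iteration provides one nonnegative solution, and the difference from
  \<open>D\<close> solves the homogeneous equation, hence vanishes.\<close>

lemma two_sided_solution_nonneg:
  assumes "0 \<le> P" "0 \<le> Q" "0 \<le> R" "R * ones \<le> ones" "(P + Q) * ones \<le> c *\<^sub>R ones" "c < 1"
    and "0 \<le> C" "D = C + P * D + Q * D * R"
  shows "0 \<le> D"
proof -
  obtain Y where Y: "0 \<le> Y" "Y = C + P * Y + Q * Y * R"
    using two_sided_fixpoint[OF assms(1-7)] by blast
  have "D - Y = (C + P * D + Q * D * R) - (C + P * Y + Q * Y * R)" using assms(8) Y(2) by simp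
  also have "\<dots> = P * (D - Y) + Q * (D - Y) * R" by (simp add: algebra_simps)
  finally have "D - Y = 0" by (rule two_sided_fixpoint_zero[OF assms(1-6)])
  with Y(1) show ?thesis by simp
qed

lemma nonneg_Neumann_inverse:
  assumes "0 \<le> N" "N * ones \<le> c *\<^sub>R ones" "c < 1"
  obtains V where "0 \<le> V" "(1 - N) * V = 1" "V * (1 - N) = 1"
proof -
  have one: "0 \<le> (1 :: linf)" by (simp add: entry_nonneg_iff one_linf.rep_eq mat_id_def)
  obtain V where V: "0 \<le> V" "V = 1 + N * V"
    using two_sided_fixpoint[of N 0 0 c 1] assms one ones_nonneg by auto
  have WV: "(1 - N) * V = 1" using V(2) by (simp add: left_diff_distrib diff_eq_eq)
  \<comment> \<open>The fixed point gives only a right inverse. The defect \<open>Y\<close> of the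
    left inverse satisfies \<open>Y = N * Y\<close>, so it is zero.\<close>
  define Y where "Y = V * (1 - N) - 1"
  have "(1 - N) * Y = ((1 - N) * V) * (1 - N) - (1 - N)"
    by (simp only: Y_def right_diff_distrib mult.assoc mult_1_right)
  then have "(1 - N) * Y = 0" by (simp add: WV)
  then have "Y = N * Y + 0 * Y * 0" by (simp add: left_diff_distrib)
  then have "Y = 0"
    by (rule two_sided_fixpoint_zero[rotated -1]) (use assms ones_nonneg in auto)
  then show thesis using that V(1) WV by (simp add: Y_def)
qed

text \<open>On row sums \<open>X\<close> drops out and \<open>K\<close> costs its norm
  \<open>t\<close>, so \<open>d \<le> d * t + c\<close> for the norm \<open>d\<close> of
  \<open>D\<close>. This is the common source of the step bound and of both quadratic
  estimates.\<close>

lemma norm_inf_le_of_fixpoint_le: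
  assumes "0 \<le> D" "0 \<le> K" "norm_inf (entry K) < 1" "X * ones \<le> ones" "C * ones \<le> c *\<^sub>R ones"
    and le: "D \<le> K * (D * X) + C"
  shows "norm_inf (entry D) \<le> c / (1 - norm_inf (entry K))"
proof -
  let ?d = "norm_inf (entry D)" and ?t = "norm_inf (entry K)"
  have "D * ones \<le> (K * (D * X) + C) * ones" using le ones_nonneg by (rule mult_right_mono)
  also have "\<dots> = K * (D * (X * ones)) + C * ones" by (simp add: distrib_right mult.assoc)
  also have "\<dots> \<le> K * (D * ones) + c *\<^sub>R ones"
    using assms by (intro add_mono mult_left_mono)
  also have "K * (D * ones) \<le> K * (?d *\<^sub>R ones)"
    using assms by (intro mult_left_mono mult_ones_le_norm)
  also have "\<dots> \<le> ?d *\<^sub>R (?t *\<^sub>R ones)"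
    using mult_ones_le_norm[OF assms(2)] by (simp del: scaleR_scaleR add: scaleR_left_mono norm_inf_entry_nonneg)
  finally have "D * ones \<le> (?d * ?t + c) *\<^sub>R ones" by (simp add: scaleR_add_left)
  then have "?d \<le> ?d * ?t + c" using assms(1) by (simp add: ones_le_iff)
  then show ?thesis using assms(3) by (simp add: field_simps)
qed

section \<open>Newton steps\<close>

text \<open>The data enter through row sums. In \<open>drift\<close> the strict entrywise inequality
  has become a uniform gap \<open>1 - \<sigma>\<close>, available because the matrices have only two
  distinct row sums each.\<close>

locale drift_triple =
  fixes Am A0 A1 :: linf and \<sigma> :: real
  assumes Am: "0 \<le> Am" and A0: "0 \<le> A0" and A1: "0 \<le> A1"
    and stochastic: "(Am + A0 + A1) * ones = ones"
    and drift: "(1 - \<sigma>) *\<^sub>R ones \<le> (Am - A1) * ones" and \<sigma>: "\<sigma> < 1"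
begin

definition resid :: "linf \<Rightarrow> linf" where
  "resid X = A1 * (X * X) + (A0 - 1) * X + Am"

definition newton_step :: "linf \<Rightarrow> linf \<Rightarrow> bool" where
  "newton_step X Z \<longleftrightarrow> (A1 * X + A0 - 1) * Z + A1 * Z * X = resid X"

lemma mult_ones_le:
  assumes "0 \<le> B" "X * ones \<le> ones"
  shows "B * (X * ones) \<le> B * ones"
  using assms by (rule mult_left_mono[rotated])

lemma quadratic_map_mult_ones_le:
  assumes "0 \<le> X" "X * ones \<le> ones"
  shows "(A1 * (X * X) + A0 * X + Am) * ones \<le> ones"
proof -
  have "X * (X * ones) \<le> ones" using mult_ones_le[OF assms] assms(2) by (rule order_trans)
  then have "A1 * (X * (X * ones)) + A0 * (X * ones) + Am * ones \<le> A1 * ones + A0 * ones + Am * ones"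
    using A0 A1 assms(2) by (intro add_mono mult_left_mono order_refl)
  also have "\<dots> = ones" using stochastic by (simp add: distrib_right add_ac)
  finally show ?thesis by (simp add: distrib_right mult.assoc)
qed

text \<open>The given \<open>G\<close> is only an entrywise minimal solution, not assumed bounded.
  This root majorizes it and thereby places it in \<open>Linf\<close> with row sums at most
  one.\<close>

lemma bounded_root_exists:
  obtains S where "0 \<le> S" "S * ones \<le> ones" "resid S = 0"
proof -
  define F where "F X = A1 * (X * X) + A0 * X + Am" for X
  obtain S where "0 \<le> S" "S * ones \<le> 1 *\<^sub>R ones" "F S = S"
  proof (rule monotone_iteration_fixpoint[of F 1])
    show "0 \<le> F X" if "0 \<le> X" for X
      unfolding F_def using A0 A1 Am that by (intro add_nonneg_nonneg mult_nonneg_nonneg)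
    show "F X \<le> F Y" if "0 \<le> X" "X \<le> Y" for X Y
      unfolding F_def using A0 A1 that order_trans[OF that] by (intro add_mono mult_left_mono mult_mono) auto
    show "F X * ones \<le> 1 *\<^sub>R ones" if "0 \<le> X" "X * ones \<le> 1 *\<^sub>R ones" for X
      using quadratic_map_mult_ones_le[of X] that by (simp add: F_def)
    show "tends (\<lambda>n. F (X n)) (F S)" if X: "tends X S" "\<And>n. 0 \<le> X n" "\<And>n. X n \<le> S" for X S
    proof -
      have S: "0 \<le> S" using X(2,3)[of 0] by (rule order_trans)
      have "tends (\<lambda>n. A1 * (X n * X n)) (A1 * (S * S))"
        by (rule tends_mult[OF tends_const tends_mult[OF X(1) X(1) X(2,3) X(2,3)] A1 order_refl,
              where C = "S * S"]) (use X S in \<open>auto intro: mult_mono\<close>)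
      then show ?thesis unfolding F_def
        by (intro tends_add tends_const tends_mult[OF tends_const X(1) A0 order_refl X(2,3)])
    qed
  qed auto
  then show thesis using that by (simp add: F_def resid_def left_diff_distrib algebra_simps)
qed

text \<open>Here the drift becomes contraction: replacing \<open>X\<close> by the identity on row
  sums gives \<open>A0 + A1 + A1\<close>, whose row sums are those of
  \<open>1 - (Am - A1)\<close>.\<close>

lemma two_sided_coefficient:
  assumes "0 \<le> X" "X * ones \<le> ones"
  shows "0 \<le> A0 + A1 * X" "(A0 + A1 * X + A1) * ones \<le> \<sigma> *\<^sub>R ones"
proof -
  show "0 \<le> A0 + A1 * X" using A0 A1 assms by simp
  have "(A0 + A1 * X + A1) * ones \<le> (A0 + A1 + A1) * ones"
    using mult_ones_le[OF A1 assms(2)] by (simp add: distrib_right mult.assoc)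
  also have "\<dots> = ones - (Am - A1) * ones" using stochastic by (simp add: algebra_simps)
  also have "\<dots> \<le> \<sigma> *\<^sub>R ones" using drift by (simp add: algebra_simps)
  finally show "(A0 + A1 * X + A1) * ones \<le> \<sigma> *\<^sub>R ones" .
qed

lemma newton_step_unique:
  assumes "0 \<le> X" "X * ones \<le> ones" "newton_step X Z" "newton_step X Z'"
  shows "Z = Z'"
proof -
  have "(A1 * X + A0 - 1) * Z + A1 * Z * X = (A1 * X + A0 - 1) * Z' + A1 * Z' * X"
    using assms(3,4) by (simp add: newton_step_def)
  then have "Z - Z' = (A0 + A1 * X) * (Z - Z') + A1 * (Z - Z') * X" by (simp add: algebra_simps)
  then have "Z - Z' = 0"
    by (rule two_sided_fixpoint_zero[OF two_sided_coefficient(1)[OF assms(1,2)] A1 assms(1,2)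
          two_sided_coefficient(2)[OF assms(1,2)] \<sigma>])
  then show ?thesis by simp
qed

text \<open>For \<open>Z = - Y\<close> the Newton equation is the two-sided equation
  \<open>Y = resid X + (A0 + A1 * X) * Y + A1 * Y * X\<close>, with nonnegative constant
  term.\<close>

lemma newton_step_exists:
  assumes "0 \<le> X" "X * ones \<le> ones" "0 \<le> resid X"
  obtains Y where "0 \<le> Y" "newton_step X (- Y)"
proof -
  obtain Y where Y: "0 \<le> Y" "Y = resid X + (A0 + A1 * X) * Y + A1 * Y * X"
    using two_sided_fixpoint[OF two_sided_coefficient(1)[OF assms(1,2)] A1 assms(1,2)
        two_sided_coefficient(2)[OF assms(1,2)] \<sigma> assms(3)] by blast
  have "newton_step X (- Y)" unfolding newton_step_def using Y(2) by (simp add: algebra_simps)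
  with Y(1) show thesis by (rule that)
qed

text \<open>The second-order expansion of the quadratic \<open>resid\<close> is exact, and the
  Newton equation cancels the terms of order zero and one.\<close>

lemma resid_newton_step:
  assumes "newton_step X (- Y)"
  shows "resid (X + Y) = A1 * (Y * Y)"
proof -
  have "resid (X + Y) = resid X + ((A1 * X + A0 - 1) * Y + A1 * Y * X) + A1 * (Y * Y)"
    by (simp add: resid_def algebra_simps)
  moreover have "(A1 * X + A0 - 1) * Y + A1 * Y * X = - resid X"
    using arg_cong[OF assms[unfolded newton_step_def], of uminus] by (simp add: add.commute)
  ultimately show ?thesis by simp
qed

end

section \<open>Estimates relative to a root with row sums at most one\<close>

locale drift_root = drift_triple +
  fixes G
  assumes G: "0 \<le> G" "G * ones \<le> ones" "resid G = 0"
begin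

abbreviation W where "W \<equiv> 1 - A0 - A1 * G"

lemma W_inverse:
  obtains V where "0 \<le> V" "W * V = 1" "V * W = 1"
proof -
  have N: "0 \<le> A0 + A1 * G" by (rule two_sided_coefficient(1)[OF G(1,2)])
  have "(A0 + A1 * G) * ones \<le> (A0 + A1 * G + A1) * ones"
    using A1 ones_nonneg by (simp add: distrib_right)
  also have "\<dots> \<le> \<sigma> *\<^sub>R ones" by (rule two_sided_coefficient(2)[OF G(1,2)])
  finally obtain V where "0 \<le> V" "(1 - (A0 + A1 * G)) * V = 1" "V * (1 - (A0 + A1 * G)) = 1"
    using nonneg_Neumann_inverse[OF N _ \<sigma>] by blast
  then show thesis using that by (simp add: algebra_simps)
qed

text \<open>These bounds compare \<open>A1 * ones\<close> with \<open>W * ones\<close>: the first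
  suffices for the constant \<gamma>, both are used for \<sigma>.\<close>

lemma W_mult_ones: "Am * ones \<le> W * ones" "W * ones \<le> ones"
proof -
  have "Am * ones = ones - A0 * ones - A1 * ones" using stochastic by (simp add: algebra_simps)
  then show "Am * ones \<le> W * ones"
    using mult_ones_le[OF A1 G(2)] by (simp add: left_diff_distrib mult.assoc)
  show "W * ones \<le> ones" using A0 A1 G(1) ones_nonneg
    by (simp add: left_diff_distrib diff_le_eq add_nonneg_nonneg)
qed

text \<open>Applying \<open>V \<ge> 0\<close> turns \<open>W * ones\<close> into
  \<open>ones\<close>.\<close>

lemma inverse_mult_A1_le:
  assumes "0 \<le> V" "V * W = 1" "A1 * ones \<le> c *\<^sub>R (W * ones)"
  shows "norm_inf (entry (V * A1)) \<le> c"
proof -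
  have "V * (A1 * ones) \<le> V * (c *\<^sub>R (W * ones))" using assms by (intro mult_left_mono)
  also have "\<dots> = c *\<^sub>R ((V * W) * ones)" by (simp add: mult.assoc)
  finally have "V * A1 * ones \<le> c *\<^sub>R ones" by (simp add: assms(2) mult.assoc)
  then show ?thesis using assms(1) A1 by (simp add: ones_le_iff)
qed

lemma norm_inverse_mult_A1:
  assumes "0 \<le> V" "V * W = 1"
  shows "norm_inf (entry (V * A1)) \<le> \<sigma>"
proof (rule inverse_mult_A1_le[OF assms])
  have "A1 * ones \<le> Am * ones - (1 - \<sigma>) *\<^sub>R ones" using drift by (simp add: algebra_simps)
  also have "\<dots> \<le> W * ones - (1 - \<sigma>) *\<^sub>R (W * ones)"
    using W_mult_ones \<sigma> by (intro diff_mono scaleR_left_mono) auto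
  finally show "A1 * ones \<le> \<sigma> *\<^sub>R (W * ones)" by (simp add: algebra_simps)
qed

lemma norm_inverse_mult_A1':
  assumes "0 \<le> V" "V * W = 1" "0 \<le> \<gamma>" "A1 * ones \<le> \<gamma> *\<^sub>R (Am * ones)"
  shows "norm_inf (entry (V * A1)) \<le> \<gamma>"
proof (rule inverse_mult_A1_le[OF assms(1,2)])
  show "A1 * ones \<le> \<gamma> *\<^sub>R (W * ones)"
    using assms(4) scaleR_left_mono[OF W_mult_ones(1) assms(3)] by (rule order_trans)
qed

lemma sub_root_mult_ones_le: "X \<le> G \<Longrightarrow> X * ones \<le> ones"
  using mult_right_mono[OF _ ones_nonneg] G(2) by (rule order_trans)

lemma error_equation:
  assumes "newton_step X (- Y)"
  shows "W * (G - (X + Y)) = A1 * ((G - (X + Y)) * X + (G - X) * Y)"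
proof -
  \<comment> \<open>Newton equation minus root equation; expanding in the ring and regrouping gives
    the claim.\<close>
  have "resid X - ((A1 * X + A0 - 1) * (- Y) + A1 * (- Y) * X) - resid G = 0"
    unfolding assms[unfolded newton_step_def] G(3) by simp
  then show ?thesis by (simp add: resid_def algebra_simps)
qed

lemma newton_step_le_root:
  assumes "0 \<le> X" "X \<le> G" "newton_step X (- Y)" "0 \<le> Y"
  shows "X + Y \<le> G"
proof -
  let ?D = "G - (X + Y)"
  have X: "X * ones \<le> ones" using assms(2) by (rule sub_root_mult_ones_le)
  have GX: "(A0 + A1 * G + A1) * ones \<le> \<sigma> *\<^sub>R ones" by (rule two_sided_coefficient(2)[OF G(1,2)])
  \<comment> \<open>A two-sided equation for the new error whose left coefficient involves
    \<open>G\<close> and whose right factor is \<open>X\<close>; its constant term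
    \<open>A1 * ((G - X) * Y)\<close> is nonnegative.\<close>
  have "?D = A1 * ((G - X) * Y) + (A0 + A1 * G) * ?D + A1 * ?D * X"
    using error_equation[OF assms(3)] by (simp add: algebra_simps)
  then have "0 \<le> ?D"
    by (rule two_sided_solution_nonneg[OF two_sided_coefficient(1)[OF G(1,2)] A1 assms(1) X GX \<sigma>, rotated])
       (use A1 assms in simp)
  then show ?thesis by simp
qed

text \<open>After multiplication by \<open>V\<close>, the bound \<open>Y \<le> G - X\<close> turns
  the mixed product in the error equation into the square of the old error.\<close>

lemma error_le:
  assumes V: "0 \<le> V" "V * W = 1" and "0 \<le> X" "X \<le> G" "newton_step X (- Y)" "0 \<le> Y"
  shows "G - (X + Y) \<le> V * A1 * ((G - (X + Y)) * X) + V * A1 * ((G - X) * (G - X))"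
proof -
  let ?D = "G - (X + Y)"
  have "0 \<le> ?D" using newton_step_le_root assms by simp
  have "Y \<le> G - X" using \<open>0 \<le> ?D\<close> by (simp add: algebra_simps)
  have "?D = V * (W * ?D)" by (simp only: mult.assoc[symmetric] V mult_1)
  also have "\<dots> = V * A1 * (?D * X + (G - X) * Y)" by (simp add: error_equation assms mult.assoc)
  also have "\<dots> \<le> V * A1 * (?D * X + (G - X) * (G - X))"
    using V A1 \<open>Y \<le> G - X\<close> assms by (intro mult_left_mono add_left_mono) auto
  finally show ?thesis by (simp add: distrib_left)
qed

text \<open>Replacing \<open>X\<close> by \<open>G\<close> in the left coefficient of the Newton
  equation leaves the term \<open>- A1 * (G - X) * Y\<close>, which is at most zero and is
  discarded.\<close>

lemma step_le:
  assumes V: "0 \<le> V" "V * W = 1" and "0 \<le> X" "X \<le> G" "newton_step X (- Y)" "0 \<le> Y"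
  shows "Y \<le> V * A1 * (Y * X) + V * resid X"
proof -
  have "Y = V * (W * Y)" by (simp only: mult.assoc[symmetric] V mult_1)
  also have "W * Y = A1 * (Y * X) + resid X - A1 * (G - X) * Y"
    using assms(5) unfolding newton_step_def by (simp add: algebra_simps)
  also have "V * \<dots> \<le> V * (A1 * (Y * X) + resid X)"
    using assms A1 by (intro mult_left_mono) (auto simp: mult_nonneg_nonneg)
  finally show ?thesis by (simp add: distrib_left mult.assoc)
qed

lemma norm_le_of_quadratic_bound:
  assumes V: "0 \<le> V" and t: "norm_inf (entry (V * A1)) < 1"
    and "0 \<le> D" "0 \<le> U" "X * ones \<le> ones" "D \<le> V * A1 * (D * X) + V * A1 * (U * U)"
  defines "t \<equiv> norm_inf (entry (V * A1))"
  shows "norm_inf (entry D) \<le> t / (1 - t) * (norm_inf (entry U))\<^sup>2"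
proof -
  have VA: "0 \<le> V * A1" using V A1 by simp
  have "norm_inf (entry (V * A1 * (U * U))) \<le> t * (norm_inf (entry U) * norm_inf (entry U))"
    unfolding t_def using VA V A1 assms(4)
    by (intro order_trans[OF norm_inf_mult_le] mult_left_mono norm_inf_mult_le norm_inf_entry_nonneg
        mult_nonneg_nonneg order_refl)
  then have "V * A1 * (U * U) * ones \<le> (t * (norm_inf (entry U))\<^sup>2) *\<^sub>R ones"
    using VA assms(4) by (subst ones_le_iff) (simp_all add: power2_eq_square mult_nonneg_nonneg)
  from norm_inf_le_of_fixpoint_le[OF assms(3) VA t assms(5) this assms(6)]
  show ?thesis by (simp add: t_def)
qed

lemma norm_step_le:
  assumes V: "0 \<le> V" "V * W = 1" and t: "norm_inf (entry (V * A1)) < 1"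
    and "0 \<le> X" "X \<le> G" "newton_step X (- Y)" "0 \<le> Y" "0 \<le> resid X"
  shows "norm_inf (entry Y) \<le> norm_inf (entry V) / (1 - norm_inf (entry (V * A1)))"
proof (rule norm_inf_le_of_fixpoint_le)
  have X: "X * ones \<le> ones" using assms(5) by (rule sub_root_mult_ones_le)
  \<comment> \<open>Dropping the subtracted \<open>X\<close> shows that the row sums of
    \<open>resid X\<close> are at most one.\<close>
  have "resid X = (A1 * (X * X) + A0 * X + Am) - X" by (simp add: resid_def algebra_simps)
  then have "resid X * ones \<le> (A1 * (X * X) + A0 * X + Am) * ones"
    using assms(4) ones_nonneg by (intro mult_right_mono) auto
  also have "\<dots> \<le> ones" using assms(4) X by (rule quadratic_map_mult_ones_le)
  finally have "V * (resid X * ones) \<le> V * ones" using V by (intro mult_left_mono)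
  also have "\<dots> \<le> norm_inf (entry V) *\<^sub>R ones" using V(1) by (rule mult_ones_le_norm)
  finally show "V * resid X * ones \<le> norm_inf (entry V) *\<^sub>R ones" by (simp add: mult.assoc)
  show "X * ones \<le> ones" by (rule X)
  show "Y \<le> V * A1 * (Y * X) + V * resid X" by (rule step_le[OF V assms(4-7)])
qed (use V(1) A1 t assms(7) in \<open>simp_all add: mult_nonneg_nonneg\<close>)

end

text \<open>With \<open>Y k\<close> in the role of \<open>- Z k\<close> all sequences are
  nonnegative. A Newton step is demanded only under bounds that ensure solvability, so a run can be
  built by choice before these bounds are proved.\<close>

locale newton_run = drift_root +
  fixes X Y :: "nat \<Rightarrow> linf"
  assumes minimal: "\<And>S. 0 \<le> S \<Longrightarrow> resid S = 0 \<Longrightarrow> G \<le> S"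
    and X_0: "X 0 = 0" and X_Suc: "\<And>k. X (Suc k) = X k + Y k"
    and Y: "\<And>k. 0 \<le> X k \<Longrightarrow> X k \<le> G \<Longrightarrow> 0 \<le> resid (X k) \<Longrightarrow> newton_step (X k) (- Y k)"
begin

lemma iterate_bounds: "0 \<le> X k \<and> X k \<le> G \<and> 0 \<le> resid (X k) \<and> 0 \<le> Y k"
proof -
  \<comment> \<open>A nonnegative solution exists, and uniqueness identifies it with
    \<open>Y k\<close>.\<close>
  have nonneg: "0 \<le> Y k" if X: "0 \<le> X k" "X k \<le> G" "0 \<le> resid (X k)" for k
  proof -
    have ones: "X k * ones \<le> ones" using X(2) by (rule sub_root_mult_ones_le)
    obtain U where "0 \<le> U" "newton_step (X k) (- U)" using newton_step_exists[OF X(1) ones X(3)] .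
    moreover from this(2) have "- U = - Y k" using newton_step_unique[OF X(1) ones _ Y[OF X]] by simp
    ultimately show ?thesis by simp
  qed
  have "0 \<le> X k \<and> X k \<le> G \<and> 0 \<le> resid (X k)"
  proof (induction k)
    case 0
    show ?case using Am G(1) by (simp add: X_0 resid_def)
  next
    case (Suc k)
    then have X: "0 \<le> X k" "X k \<le> G" "0 \<le> resid (X k)" by simp_all
    have Yk: "0 \<le> Y k" "newton_step (X k) (- Y k)" by (rule nonneg[OF X], rule Y[OF X])
    have "0 \<le> X (Suc k)" using X(1) Yk(1) by (simp add: X_Suc)
    moreover have "X (Suc k) \<le> G" unfolding X_Suc by (rule newton_step_le_root[OF X(1,2) Yk(2,1)])
    moreover have "0 \<le> resid (X (Suc k))"
      unfolding X_Suc resid_newton_step[OF Yk(2)] using A1 Yk(1) by (simp add: mult_nonneg_nonneg)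
    ultimately show ?case by simp
  qed
  then show ?thesis using nonneg by blast
qed

lemma X_nonneg: "0 \<le> X k" and X_le: "X k \<le> G" and resid_X_nonneg: "0 \<le> resid (X k)"
  and Y_nonneg: "0 \<le> Y k"
  using iterate_bounds[of k] by simp_all

lemma newton_step_iterate: "newton_step (X k) (- Y k)"
  by (rule Y[OF X_nonneg X_le resid_X_nonneg])

lemma resid_X_Suc: "resid (X (Suc k)) = A1 * (Y k * Y k)"
  unfolding X_Suc by (rule resid_newton_step[OF newton_step_iterate])

lemma iterates_tend_to_root: "tends X G"
proof -
  note XG = X_nonneg X_le
  have "X k \<le> X (Suc k)" for k using Y_nonneg[of k] by (simp add: X_Suc)
  moreover have "X k * ones \<le> 1 *\<^sub>R ones" for k using sub_root_mult_ones_le[OF XG(2)] by simp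
  ultimately obtain S where S: "tends X S" "\<And>k. X k \<le> S"
    using increasing_bounded_tends[of X 1, OF _ XG(1)] by blast
  have Y_eq: "Y k = X (Suc k) - X k" for k by (simp add: X_Suc)
  \<comment> \<open>This leads to the fixed majorant \<open>G\<close> of all steps, as the limit of
    \<open>Y k * Y k\<close> requires.\<close>
  have "Y k \<le> X (Suc k)" for k using XG(1)[of k] by (simp add: Y_eq)
  then have Y_le: "Y k \<le> G" for k using XG(2) order_trans by blast
  have "tends Y 0" using tends_diff[OF tends_Suc[OF S(1)] S(1)] by (simp add: Y_eq[symmetric])
  from tends_mult[OF this this Y_nonneg Y_le Y_nonneg Y_le]
  have YY: "tends (\<lambda>k. Y k * Y k) 0" by simp
  have "tends (\<lambda>k. A1 * (Y k * Y k)) (A1 * 0)"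
    by (rule tends_mult[OF tends_const YY A1 order_refl, where C = "G * G"])
       (use Y_nonneg Y_le G(1) in \<open>auto intro: mult_mono\<close>)
  then have lim0: "tends (\<lambda>k. resid (X (Suc k))) 0" by (simp add: resid_X_Suc)
  have A1XX: "tends (\<lambda>k. A1 * (X k * X k)) (A1 * (S * S))"
    by (rule tends_mult[OF tends_const tends_mult[OF S(1) S(1) XG XG] A1 order_refl, where C = "G * G"])
       (use XG G(1) in \<open>auto intro: mult_mono\<close>)
  have "tends (\<lambda>k. A1 * (X k * X k) + (A0 * X k - X k) + Am) (A1 * (S * S) + (A0 * S - S) + Am)"
    by (intro tends_add tends_diff tends_const A1XX S(1) tends_mult[OF tends_const S(1) A0 order_refl XG])
  then have "tends (\<lambda>k. resid (X k)) (resid S)" by (simp add: resid_def left_diff_distrib)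
  from tends_unique[OF tends_Suc[OF this] lim0] have "resid S = 0" .
  moreover have "0 \<le> S" using XG(1) S(2) by (rule order_trans)
  \<comment> \<open>Minimality of \<open>G\<close> gives this direction; the other holds because
    \<open>G\<close> bounds all iterates.\<close>
  ultimately have GS: "G \<le> S" by (intro minimal)
  have "S \<le> G" unfolding entry_le_iff
  proof (intro allI)
    fix i j
    show "entry S i j \<le> entry G i j"
      by (rule LIMSEQ_le_const2[of "\<lambda>k. entry (X k) i j"]) (use S(1) entry_mono[OF XG(2)] in \<open>auto simp: tends_def\<close>)
  qed
  then show ?thesis using order_antisym[OF GS] S(1) by simp
qed

lemma error_quadratic:
  assumes V: "0 \<le> V" "V * W = 1" and t: "norm_inf (entry (V * A1)) < 1"
  defines "t \<equiv> norm_inf (entry (V * A1))"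
  shows "norm_inf (entry (G - X (Suc k))) \<le> t / (1 - t) * (norm_inf (entry (G - X k)))\<^sup>2"
  unfolding t_def
proof (rule norm_le_of_quadratic_bound[OF V(1) t])
  show "G - X (Suc k) \<le> V * A1 * ((G - X (Suc k)) * X k) + V * A1 * ((G - X k) * (G - X k))"
    unfolding X_Suc by (rule error_le[OF V X_nonneg X_le newton_step_iterate Y_nonneg])
qed (simp_all add: X_le sub_root_mult_ones_le)

lemma step_quadratic:
  assumes V: "0 \<le> V" "V * W = 1" and t: "norm_inf (entry (V * A1)) < 1"
  defines "t \<equiv> norm_inf (entry (V * A1))"
  shows "norm_inf (entry (Y (Suc k))) \<le> t / (1 - t) * (norm_inf (entry (Y k)))\<^sup>2"
  unfolding t_def
proof (rule norm_le_of_quadratic_bound[OF V(1) t])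
  \<comment> \<open>The residual in the step inequality is the square left by the previous
    step.\<close>
  show "Y (Suc k) \<le> V * A1 * (Y (Suc k) * X (Suc k)) + V * A1 * (Y k * Y k)"
    using step_le[OF V X_nonneg X_le newton_step_iterate Y_nonneg, of "Suc k"]
    by (simp add: resid_X_Suc mult.assoc)
qed (simp_all add: Y_nonneg sub_root_mult_ones_le X_le)

end

section \<open>The quasi-birth-death matrices\<close>

lemma Linf_qbd_matrix: "qbd_matrix a b i \<in> Linf"
proof (rule Linf_finite_rows)
  fix r :: nat
  let ?S = "if r = 0 then {0, 1} else {r - 1, r, r + 1}"
  show "finite ?S" by simp
  show "qbd_matrix a b i r s = 0" if "s \<notin> ?S" for s
    using that by (auto simp: qbd_matrix_def split: if_splits)
  show "(\<Sum>s\<in>?S. \<bar>qbd_matrix a b i r s\<bar>) \<le> \<bar>b i 0\<bar> + \<bar>b i 1\<bar> + \<bar>a i (-1)\<bar> + \<bar>a i 0\<bar> + \<bar>a i 1\<bar>"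
    by (cases r) (auto simp: qbd_matrix_def)
qed

lemma entry_zero_fun: "entry 0 = 0"
  by (simp add: zero_linf.rep_eq zero_fun_def)

lemma entry_uminus_fun: "entry (- X) = - entry X"
  by (intro ext) (simp add: entry_minus)

lemma entry_diff_fun: "entry (X - Y) = entry X - entry Y"
  by (intro ext) (simp add: entry_diff)

lemmas entry_simps = entry_zero_fun one_linf.rep_eq plus_linf.rep_eq entry_diff_fun times_linf.rep_eq

lemma mat_mult_defined_Linf: "A \<in> Linf \<Longrightarrow> B \<in> Linf \<Longrightarrow> mat_mult_defined A B"
  unfolding mat_mult_defined_def by (intro allI Linf_summable Bseq_column)

text \<open>Two-sided inverses are unique by associativity, so the description in
  \<open>Linf_inv\<close> denotes \<open>V\<close>.\<close>

lemma Linf_inv_eq: "V * U = 1 \<Longrightarrow> U * V = 1 \<Longrightarrow> is_Linf_inverse (entry U) (entry V) \<and> Linf_inv (entry U) = entry V"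
proof -
  assume inv: "V * U = 1" "U * V = 1"
  then have V: "is_Linf_inverse (entry U) (entry V)"
    by (simp add: is_Linf_inverse_def times_linf.rep_eq[symmetric] one_linf.rep_eq[symmetric])
  have "V' = entry V" if "is_Linf_inverse (entry U) V'" for V'
  proof -
    from that obtain T where T: "V' = entry T" by (metis is_Linf_inverse_def linf_of_inverse)
    with that have "U * T = 1"
      by (simp add: is_Linf_inverse_def times_linf.rep_eq[symmetric] one_linf.rep_eq[symmetric] entry_inject)
    then have "V * (U * T) = V" by simp
    then show ?thesis by (simp add: mult.assoc[symmetric] inv T)
  qed
  with V show ?thesis unfolding Linf_inv_def by (blast intro: the_equality)
qed

section \<open>Translation between the ring and the matrix predicates\<close>

context drift_triple
begin

lemma quadratic_solution_entry_iff:
  assumes "entry Am = A (-1)" "entry A0 = A 0" "entry A1 = A 1"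
  shows "quadratic_solution A (entry S) \<longleftrightarrow> resid S = 0"
proof -
  have "quadratic_solution A (entry S) \<longleftrightarrow> entry (A1 * (S * S) + A0 * S + Am) = entry S"
    by (simp add: quadratic_solution_def entry_simps assms mat_mult_defined_Linf)
  also have "\<dots> \<longleftrightarrow> resid S = 0"
    unfolding entry_inject by (simp add: resid_def algebra_simps)
  finally show ?thesis .
qed

lemma entry_resid:
  assumes "entry Am = A (-1)" "entry A0 = A 0" "entry A1 = A 1"
  shows "entry (resid X) = L_residual A (entry X)"
  by (simp add: resid_def L_residual_def entry_simps assms)

lemma newton_equation_entry_iff:
  assumes "entry Am = A (-1)" "entry A0 = A 0" "entry A1 = A 1"
  shows "newton_equation A (entry X) (entry Z) \<longleftrightarrow> newton_step X Z"
  unfolding newton_step_def entry_inject[symmetric] entry_resid[of A, OF assms]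
  by (simp add: newton_equation_def entry_simps assms)

end

context drift_root
begin

text \<open>A reference run, with steps picked by choice, to which any given Newton iteration is
  compared.\<close>

lemma newton_run_exists:
  assumes "\<And>S. 0 \<le> S \<Longrightarrow> resid S = 0 \<Longrightarrow> G \<le> S"
  obtains X Y where "newton_run Am A0 A1 \<sigma> G X Y"
proof -
  define y where "y x = (SOME u. newton_step x (- u))" for x
  define X where "X = rec_nat 0 (\<lambda>_ x. x + y x)"
  have y: "newton_step x (- y x)" if "0 \<le> x" "x \<le> G" "0 \<le> resid x" for x
    unfolding y_def using newton_step_exists[OF that(1) sub_root_mult_ones_le[OF that(2)] that(3)]
    by (metis someI_ex)
  have "newton_run Am A0 A1 \<sigma> G X (\<lambda>k. y (X k))"
    by unfold_locales (use assms y in \<open>auto simp: X_def\<close>)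
  then show thesis by (rule that)
qed

end

theorem theorem5p1:
  fixes a b :: "int \<Rightarrow> int \<Rightarrow> real"
    and A :: "int \<Rightarrow> inf_mat"
    and G W :: inf_mat
    and X Z E :: "nat \<Rightarrow> inf_mat"
    and \<beta> \<gamma> \<sigma> \<tau> :: real
  assumes a_nonneg: "\<And>i j. i \<in> {-1..1} \<Longrightarrow> j \<in> {-1..1} \<Longrightarrow> a i j \<ge> 0"
    and b_nonneg: "\<And>i j. i \<in> {-1..1} \<Longrightarrow> j \<in> {0..1} \<Longrightarrow> b i j \<ge> 0"
    and a_sum: "(\<Sum>i=-1..1. \<Sum>j=-1..1. a i j) = 1"
    and b_sum: "(\<Sum>i=-1..1. \<Sum>j=0..1. b i j) = 1"
    and A_eq: "A = qbd_matrix a b"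
    and drift: "\<And>r. mat_vec (A (-1)) 1 r > mat_vec (A 1) 1 r"
    and G_min: "minimal_nonneg_solution A G"
    and W_eq: "W = mat_id - A 0 - A 1 \<odot> G"
    and newton: "newton_iteration A X Z"
    and \<beta>_eq: "\<beta> = 2 * norm_inf (Linf_inv W) / (1 - norm_inf (Linf_inv W \<odot> A 1))"
    and E_eq: "\<And>k. E k = G - X k"
    and \<gamma>_eq: "\<gamma> = max (a_symbol a 1 1 / a_symbol a (-1) 1) (b_symbol b 1 1 / b_symbol b (-1) 1)"
    and \<sigma>_eq: "\<sigma> = 1 - min (a_symbol a (-1) 1 - a_symbol a 1 1) (b_symbol b (-1) 1 - b_symbol b 1 1)"
    and \<tau>_eq: "\<tau> = min \<gamma> \<sigma>"
  shows "G \<in> Linf \<and> is_Linf_inverse W (Linf_inv W) \<and> norm_inf (Linf_inv W \<odot> A 1) < 1 \<and>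
    (\<forall>k. newton_equation A (X k) (Z k) \<and> norm_inf (Z k) \<le> \<beta>) \<and>
    (\<forall>k. Z k \<le> 0 \<and> L_residual A (X (Suc k)) \<ge> 0 \<and>
         0 \<le> X k \<and> X k \<le> X (Suc k) \<and> X (Suc k) \<le> G) \<and>
    (\<forall>i j. (\<lambda>k. E k i j) \<longlonglongrightarrow> 0) \<and>
    (\<forall>k. norm_inf (E (Suc k)) \<le> \<tau> / (1 - \<tau>) * (norm_inf (E k))\<^sup>2 \<and>
         norm_inf (Z (Suc k)) \<le> \<tau> / (1 - \<tau>) * (norm_inf (Z k))\<^sup>2)"
proof -
  have sym_int: "{-1..1} = {-1, 0, 1 :: int}" "{0..1} = {0, 1 :: int}" by auto
  define Am A0 A1 where "Am = linf_of (A (-1))" and "A0 = linf_of (A 0)" and "A1 = linf_of (A 1)"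
  have A_Linf: "A i \<in> Linf" for i unfolding A_eq by (rule Linf_qbd_matrix)
  have ent: "entry Am = A (-1)" "entry A0 = A 0" "entry A1 = A 1"
    by (simp_all add: Am_def A0_def A1_def linf_of_inverse A_Linf)
  have A_nonneg: "0 \<le> A i r s" if "i \<in> {-1..1}" for i r s
    using that a_nonneg b_nonneg by (simp add: A_eq qbd_matrix_def)
  have row: "mat_vec (A i) 1 r = (if r = 0 then b_symbol b i 1 else a_symbol a i 1)" for i r
    unfolding A_eq by (rule mat_vec_qbd_matrix_1)
  have dr: "a_symbol a 1 1 < a_symbol a (-1) 1" "b_symbol b 1 1 < b_symbol b (-1) 1"
    using drift[of 1] drift[of 0] by (simp_all add: row)
  have sym_nonneg: "0 \<le> a_symbol a 1 1" "0 \<le> b_symbol b 1 1"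
    by (simp_all add: a_symbol_def b_symbol_def a_nonneg b_nonneg)
  interpret T: drift_triple Am A0 A1 \<sigma>
  proof
    show "0 \<le> Am" "0 \<le> A0" "0 \<le> A1" by (simp_all add: entry_nonneg_iff ent A_nonneg)
    show "(Am + A0 + A1) * ones = ones"
      using a_sum b_sum by (intro entry_eqI)
        (simp add: distrib_right entry_add entry_mult_ones ent row ones.rep_eq a_symbol_def b_symbol_def sym_int)
    show "(1 - \<sigma>) *\<^sub>R ones \<le> (Am - A1) * ones"
      by (simp add: left_diff_distrib entry_le_iff entry_diff entry_scaleR entry_mult_ones ent row ones.rep_eq \<sigma>_eq)
    show "\<sigma> < 1" using dr by (simp add: \<sigma>_eq)
  qed
  \<comment> \<open>The drift makes both denominators positive, since the numerators are
    nonnegative.\<close>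
  have \<gamma>: "0 \<le> \<gamma>" "\<gamma> < 1"
    using dr sym_nonneg by (auto simp: \<gamma>_eq le_max_iff_disj)
  have A1_le: "A1 * ones \<le> \<gamma> *\<^sub>R (Am * ones)"
  proof -
    have "a_symbol a 1 1 \<le> \<gamma> * a_symbol a (-1) 1" "b_symbol b 1 1 \<le> \<gamma> * b_symbol b (-1) 1"
      using dr sym_nonneg by (simp_all add: \<gamma>_eq pos_divide_le_eq[symmetric])
    then show ?thesis by (simp add: entry_le_iff entry_scaleR entry_mult_ones ent row)
  qed
  obtain S where S: "0 \<le> S" "S * ones \<le> ones" "T.resid S = 0" by (rule T.bounded_root_exists)
  have G: "quadratic_solution A G" "0 \<le> G" "\<And>U. quadratic_solution A U \<Longrightarrow> 0 \<le> U \<Longrightarrow> G \<le> U"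
    using G_min by (auto simp: minimal_nonneg_solution_def)
  have entry_nonneg_fun: "0 \<le> entry U" if "0 \<le> U" for U
    using that by (simp add: less_eq_linf.rep_eq entry_zero_fun)
  have G_le: "G \<le> entry U" if "0 \<le> U" "T.resid U = 0" for U
    using that by (intro G(3)) (simp_all add: T.quadratic_solution_entry_iff[OF ent] entry_nonneg_fun)
  have "\<bar>G i j\<bar> \<le> \<bar>entry S i j\<bar>" for i j
    using G_le[OF S(1,3)] G(2) by (auto simp: le_fun_def intro: order_trans[OF _ abs_ge_self])
  then have G_Linf: "G \<in> Linf" by (rule Linf_dominated[OF entry_in_Linf])
  then obtain H where H: "G = entry H" by (metis linf_of_inverse)
  have H_le: "H \<le> U" if "0 \<le> U" "T.resid U = 0" for U
    using G_le[OF that] by (simp add: H less_eq_linf.rep_eq)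
  interpret R: drift_root Am A0 A1 \<sigma> H
  proof
    show "0 \<le> H" using G(2) by (simp add: H less_eq_linf.rep_eq entry_zero_fun)
    show "H * ones \<le> ones" using mult_right_mono[OF H_le[OF S(1,3)] ones_nonneg] S(2) by (rule order_trans)
    show "T.resid H = 0" using G(1) by (simp add: H T.quadratic_solution_entry_iff[OF ent])
  qed
  obtain x y where "newton_run Am A0 A1 \<sigma> H x y" using R.newton_run_exists H_le by blast
  then interpret N: newton_run Am A0 A1 \<sigma> H x y .
  \<comment> \<open>Solvability at \<open>x k\<close> forces \<open>Z k\<close> to be a solution,
    and uniqueness of the step identifies it.\<close>
  have Z_eq: "newton_equation A (X k) (Z k) \<and> Z k = entry (- y k)" if "X k = entry (x k)" for k
  proof -
    have "newton_equation A (X k) (entry (- y k))"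
      unfolding that T.newton_equation_entry_iff[OF ent] by (rule N.newton_step_iterate)
    then have eq: "newton_equation A (X k) (Z k)" using newton by (auto simp: newton_iteration_def)
    then obtain z where z: "Z k = entry z" by (metis newton_equation_def linf_of_inverse)
    have "T.newton_step (x k) z" using eq by (simp add: that z T.newton_equation_entry_iff[OF ent])
    from T.newton_step_unique[OF N.X_nonneg R.sub_root_mult_ones_le[OF N.X_le] this N.newton_step_iterate]
    show ?thesis using eq z by simp
  qed
  have X_eq: "X k = entry (x k)" for k
  proof (induction k)
    case 0
    show ?case using newton by (simp add: newton_iteration_def N.X_0 entry_zero_fun)
  next
    case (Suc k)
    have "X (Suc k) = X k - Z k" using newton by (simp add: newton_iteration_def)
    then show ?case using Suc Z_eq[OF Suc] by (simp add: N.X_Suc plus_linf.rep_eq entry_uminus_fun)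
  qed
  note Z = Z_eq[OF X_eq]
  have norm_Z: "norm_inf (Z k) = norm_inf (entry (y k))" for k
    using Z[of k] norm_inf_abs[of "- y k"] by (simp add: norm_inf_abs)
  have E: "E k = entry (H - x k)" for k by (simp add: E_eq H X_eq entry_diff_fun)
  obtain V where V: "0 \<le> V" "R.W * V = 1" "V * R.W = 1" by (rule R.W_inverse)
  have W: "W = entry R.W" by (simp add: W_eq entry_simps ent H)
  have inv: "is_Linf_inverse W (Linf_inv W)" "Linf_inv W = entry V"
    using Linf_inv_eq[OF V(3,2)] by (simp_all add: W)
  define t where "t = norm_inf (entry (V * A1))"
  have t: "norm_inf (Linf_inv W \<odot> A 1) = t" by (simp add: t_def inv times_linf.rep_eq ent)
  have t_le: "t \<le> \<tau>" "\<tau> < 1"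
    using R.norm_inverse_mult_A1[OF V(1,3)] R.norm_inverse_mult_A1'[OF V(1,3) \<gamma>(1) A1_le] \<gamma>(2)
    by (simp_all add: \<tau>_eq t_def)
  then have t1: "norm_inf (entry (V * A1)) < 1" by (simp add: t_def)
  \<comment> \<open>The function t/(1-t) is increasing for t < 1, so the estimates with
    \<open>t\<close> imply those with \<tau>.\<close>
  have ratio: "t / (1 - t) * u\<^sup>2 \<le> \<tau> / (1 - \<tau>) * u\<^sup>2" for u
    using t_le norm_inf_entry_nonneg[of "V * A1"] by (intro mult_right_mono frac_le) (auto simp: t_def)
  have "norm_inf (Z k) \<le> \<beta>" for k
  proof -
    have "norm_inf (Z k) \<le> norm_inf (entry V) / (1 - t)" unfolding norm_Z t_def
      by (rule R.norm_step_le[OF V(1,3) t1 N.X_nonneg N.X_le N.newton_step_iterate N.Y_nonneg N.resid_X_nonneg])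
    \<comment> \<open>The bound just obtained is half of \<beta>.\<close>
    also have "\<dots> \<le> \<beta>" unfolding \<beta>_eq t unfolding inv(2) using t_le norm_inf_entry_nonneg[of V]
      by (intro divide_right_mono) auto
    finally show ?thesis .
  qed
  moreover have "norm_inf (E (Suc k)) \<le> \<tau> / (1 - \<tau>) * (norm_inf (E k))\<^sup>2" for k
    using N.error_quadratic[OF V(1,3) t1, of k] ratio unfolding E t_def[symmetric] by (rule order_trans)
  moreover have "norm_inf (Z (Suc k)) \<le> \<tau> / (1 - \<tau>) * (norm_inf (Z k))\<^sup>2" for k
    using N.step_quadratic[OF V(1,3) t1, of k] ratio unfolding norm_Z t_def[symmetric] by (rule order_trans)
  moreover have "Z k \<le> 0" for k
    using N.Y_nonneg[of k] Z[of k] by (simp add: le_fun_def entry_minus entry_nonneg_iff)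
  moreover have "L_residual A (X (Suc k)) \<ge> 0" for k
    unfolding X_eq T.entry_resid[OF ent, symmetric] by (rule entry_nonneg_fun[OF N.resid_X_nonneg])
  moreover have "0 \<le> X k" for k unfolding X_eq by (rule entry_nonneg_fun[OF N.X_nonneg])
  moreover have "X k \<le> X (Suc k)" for k
    unfolding X_eq N.X_Suc less_eq_linf.rep_eq[symmetric] using N.Y_nonneg[of k] by simp
  moreover have "X (Suc k) \<le> G" for k
    unfolding X_eq H less_eq_linf.rep_eq[symmetric] by (rule N.X_le)
  moreover have "(\<lambda>k. E k i j) \<longlonglongrightarrow> 0" for i j
    using tends_diff[OF tends_const[of H] N.iterates_tend_to_root]
    by (simp add: E tends_def zero_linf.rep_eq)
  ultimately show ?thesis using G_Linf inv(1) t t_le Z[THEN conjunct1] by simp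
qed

end
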